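(* Let $A$ be a complex affine Poisson algebra. Suppose ${\rm P.spec}\,A=\bigcup_i X_i$ is a union of locally closed subsets such that each $X_i$, endowed with the subspace topology, is homeomorphic to ${\rm P.spec}\,A_i$ for some complex affine Poisson algebra $A_i$. Then $A$ satisfies the Poisson Dixmier-Moeglin equivalence if and only if each $A_i$ satisfies the Poisson Dixmier-Moeglin equivalence.
   Context: A complex affine Poisson algebra is a finitely generated commutative $\mathbb{C}$-algebra $A$ with a bilinear map $\{-,-\}:A\times A\to A$ that is both a Lie bracket and a biderivation. An ideal $I$ is a Poisson ideal if $\{I,A\}\subseteq I$. The Poisson core of an ideal $J$ is the largest Poisson ideal contained in $J$. A Poisson primitive ideal is the Poisson core of a maximal ideal of $A$. A Poisson prime ideal is a prime ideal that is also a Poisson ideal; ${\rm P.spec}\,A$ denotes the set of Poisson prime ideals with the subspace topology from ${\rm spec}\,A$ (Zariski topology). The Poisson center of a Poisson algebra $B$ is $Z_P(B)=\{a\in B : \{a,b\}=0\ \forall b\in B\}$. For a Poisson prime ideal $P$, the Poisson bracket of $A$ induces one on $A/P$ and extends uniquely to ${\rm Frac}(A/P)$; $P$ is Poisson rational if $Z_P({\rm Frac}(A/P))=\mathbb{C}$. A subset of a topological space is locally closed if it is the intersection of an open and a closed subset; a Poisson prime ideal $P$ is locally closed if $\{P\}$ is locally closed in ${\rm P.spec}\,A$. $A$ satisfies the Poisson Dixmier-Moeglin equivalence if the following three sets of Poisson prime ideals coincide: the locally closed Poisson prime ideals, the Poisson primitive ideals, and the Poisson rational ideals. *)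

theory Defs
  imports "HOL-Algebra.Algebra" "HOL-Algebra.Algebraic_Closure_Type" "HOL-Analysis.Abstract_Topology"
begin

section \<open>Complex affine Poisson algebras\<close>

record 'a poisson_alg = "(complex, 'a) module" +
  pbracket :: "'a \<Rightarrow> 'a \<Rightarrow> 'a" (\<open>\<lbrace>_, _\<rbrace>\<index>\<close>)

abbreviation complex_ring :: "complex ring" where
  "complex_ring \<equiv> ring_of_type_algebra"

locale poisson_algebra = algebra complex_ring A for A :: "'a poisson_alg" (structure) +
  assumes pbracket_closed [simp, intro]:
      "\<lbrakk>x \<in> carrier A; y \<in> carrier A\<rbrakk> \<Longrightarrow> \<lbrace>x, y\<rbrace> \<in> carrier A"
    and pbracket_add_left:
      "\<lbrakk>x \<in> carrier A; y \<in> carrier A; z \<in> carrier A\<rbrakk> \<Longrightarrow> \<lbrace>x \<oplus> y, z\<rbrace> = \<lbrace>x, z\<rbrace> \<oplus> \<lbrace>y, z\<rbrace>"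
    and pbracket_add_right:
      "\<lbrakk>x \<in> carrier A; y \<in> carrier A; z \<in> carrier A\<rbrakk> \<Longrightarrow> \<lbrace>x, y \<oplus> z\<rbrace> = \<lbrace>x, y\<rbrace> \<oplus> \<lbrace>x, z\<rbrace>"
    and pbracket_smult_left:
      "\<lbrakk>x \<in> carrier A; y \<in> carrier A\<rbrakk> \<Longrightarrow> \<lbrace>c \<odot> x, y\<rbrace> = c \<odot> \<lbrace>x, y\<rbrace>"
    and pbracket_smult_right:
      "\<lbrakk>x \<in> carrier A; y \<in> carrier A\<rbrakk> \<Longrightarrow> \<lbrace>x, c \<odot> y\<rbrace> = c \<odot> \<lbrace>x, y\<rbrace>"
    and pbracket_alternating [simp]:
      "x \<in> carrier A \<Longrightarrow> \<lbrace>x, x\<rbrace> = \<zero>"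
    and pbracket_Jacobi:
      "\<lbrakk>x \<in> carrier A; y \<in> carrier A; z \<in> carrier A\<rbrakk> \<Longrightarrow>
        \<lbrace>x, \<lbrace>y, z\<rbrace>\<rbrace> \<oplus> \<lbrace>y, \<lbrace>z, x\<rbrace>\<rbrace> \<oplus> \<lbrace>z, \<lbrace>x, y\<rbrace>\<rbrace> = \<zero>"
    and pbracket_Leibniz_left:
      "\<lbrakk>x \<in> carrier A; y \<in> carrier A; z \<in> carrier A\<rbrakk> \<Longrightarrow>
        \<lbrace>x \<otimes> y, z\<rbrace> = x \<otimes> \<lbrace>y, z\<rbrace> \<oplus> y \<otimes> \<lbrace>x, z\<rbrace>"
    and pbracket_Leibniz_right:
      "\<lbrakk>x \<in> carrier A; y \<in> carrier A; z \<in> carrier A\<rbrakk> \<Longrightarrow>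
        \<lbrace>x, y \<otimes> z\<rbrace> = y \<otimes> \<lbrace>x, z\<rbrace> \<oplus> z \<otimes> \<lbrace>x, y\<rbrace>"

text \<open>The subalgebra generated by \<open>F\<close> is the subring generated by \<open>F\<close> and the scalars.
  As usual, the zero algebra is allowed.\<close>

locale affine_poisson_algebra = poisson_algebra +
  assumes finitely_generated:
    "\<exists>F. finite F \<and> F \<subseteq> carrier A \<and>
       generate_ring A (range (\<lambda>c. c \<odot> \<one>) \<union> F) = carrier A"


section \<open>Poisson ideals and the Poisson spectrum\<close>

definition poisson_ideal :: "'a poisson_alg \<Rightarrow> 'a set \<Rightarrow> bool" where
  "poisson_ideal A I \<longleftrightarrow> ideal I A \<and> (\<forall>x\<in>I. \<forall>y\<in>carrier A. \<lbrace>x, y\<rbrace>\<^bsub>A\<^esub> \<in> I)"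

definition poisson_core :: "'a poisson_alg \<Rightarrow> 'a set \<Rightarrow> 'a set" where
  "poisson_core A J = (GREATEST I. poisson_ideal A I \<and> I \<subseteq> J)"

definition poisson_primitive :: "'a poisson_alg \<Rightarrow> 'a set \<Rightarrow> bool" where
  "poisson_primitive A P \<longleftrightarrow> (\<exists>M. maximalideal M A \<and> P = poisson_core A M)"

definition poisson_spec :: "'a poisson_alg \<Rightarrow> 'a set set" where
  "poisson_spec A = {P. primeideal P A \<and> poisson_ideal A P}"

definition zariski_topology :: "('a, 'm) ring_scheme \<Rightarrow> 'a set topology" where
  "zariski_topology R =
     topology (\<lambda>U. \<exists>S\<subseteq>carrier R. U = {P. primeideal P R} - {P. primeideal P R \<and> S \<subseteq> P})"

definition poisson_spec_topology :: "'a poisson_alg \<Rightarrow> 'a set topology" where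
  "poisson_spec_topology A = subtopology (zariski_topology A) (poisson_spec A)"

definition locally_closed_in :: "'a topology \<Rightarrow> 'a set \<Rightarrow> bool" where
  "locally_closed_in T S \<longleftrightarrow> (\<exists>U C. openin T U \<and> closedin T C \<and> S = U \<inter> C)"


section \<open>Quotients and fraction fields\<close>

text \<open>The quotient ring, with scalar multiplication and bracket induced on cosets in the same
  way as \<^const>\<open>rcoset_mult\<close>.\<close>

definition poisson_quot :: "'a poisson_alg \<Rightarrow> 'a set \<Rightarrow> 'a set poisson_alg" where
  "poisson_quot A I =
    \<lparr>carrier = carrier (A Quot I), monoid.mult = monoid.mult (A Quot I),
     one = monoid.one (A Quot I), ring.zero = ring.zero (A Quot I), add = ring.add (A Quot I),
     module.smult = (\<lambda>c U. \<Union>x\<in>U. I +>\<^bsub>A\<^esub> (c \<odot>\<^bsub>A\<^esub> x)),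
     pbracket = (\<lambda>U V. \<Union>x\<in>U. \<Union>y\<in>V. I +>\<^bsub>A\<^esub> \<lbrace>x, y\<rbrace>\<^bsub>A\<^esub>)\<rparr>"

definition frac_rel :: "('a, 'm) ring_scheme \<Rightarrow> (('a \<times> 'a) \<times> ('a \<times> 'a)) set" where
  "frac_rel R =
    {((a, b), (c, d)). a \<in> carrier R \<and> b \<in> carrier R - {\<zero>\<^bsub>R\<^esub>} \<and>
       c \<in> carrier R \<and> d \<in> carrier R - {\<zero>\<^bsub>R\<^esub>} \<and> a \<otimes>\<^bsub>R\<^esub> d = c \<otimes>\<^bsub>R\<^esub> b}"

definition fraction :: "('a, 'm) ring_scheme \<Rightarrow> 'a \<Rightarrow> 'a \<Rightarrow> ('a \<times> 'a) set" where
  "fraction R a b = frac_rel R `` {(a, b)}"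

text \<open>The fraction field of a Poisson algebra that is a domain. The biderivation rule forces
  \<open>{1/b, x} = - {b, x}/b\<^sup>2\<close>, hence
  \<open>{a/b, c/d} = (bd{a,c} - bc{a,d} - ad{b,c} + ac{b,d}) / (b\<^sup>2d\<^sup>2)\<close>
  for every bracket extending the given one; see \<open>pbracket_frac\<close> and \<open>pbracket_frac_one\<close>
  below for well-definedness and the extension property.\<close>

definition poisson_frac :: "'a poisson_alg \<Rightarrow> ('a \<times> 'a) set poisson_alg" where
  "poisson_frac A =
    \<lparr>carrier = (carrier A \<times> (carrier A - {\<zero>\<^bsub>A\<^esub>})) // frac_rel A,
     monoid.mult = (\<lambda>U V. \<Union>(a, b)\<in>U. \<Union>(c, d)\<in>V. fraction A (a \<otimes>\<^bsub>A\<^esub> c) (b \<otimes>\<^bsub>A\<^esub> d)),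
     one = fraction A \<one>\<^bsub>A\<^esub> \<one>\<^bsub>A\<^esub>,
     ring.zero = fraction A \<zero>\<^bsub>A\<^esub> \<one>\<^bsub>A\<^esub>,
     add = (\<lambda>U V. \<Union>(a, b)\<in>U. \<Union>(c, d)\<in>V.
              fraction A (a \<otimes>\<^bsub>A\<^esub> d \<oplus>\<^bsub>A\<^esub> c \<otimes>\<^bsub>A\<^esub> b) (b \<otimes>\<^bsub>A\<^esub> d)),
     module.smult = (\<lambda>k U. \<Union>(a, b)\<in>U. fraction A (k \<odot>\<^bsub>A\<^esub> a) b),
     pbracket = (\<lambda>U V. \<Union>(a, b)\<in>U. \<Union>(c, d)\<in>V.
       fraction A
         (d \<otimes>\<^bsub>A\<^esub> (b \<otimes>\<^bsub>A\<^esub> \<lbrace>a, c\<rbrace>\<^bsub>A\<^esub> \<ominus>\<^bsub>A\<^esub> a \<otimes>\<^bsub>A\<^esub> \<lbrace>b, c\<rbrace>\<^bsub>A\<^esub>) \<ominus>\<^bsub>A\<^esub>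
          c \<otimes>\<^bsub>A\<^esub> (b \<otimes>\<^bsub>A\<^esub> \<lbrace>a, d\<rbrace>\<^bsub>A\<^esub> \<ominus>\<^bsub>A\<^esub> a \<otimes>\<^bsub>A\<^esub> \<lbrace>b, d\<rbrace>\<^bsub>A\<^esub>))
         ((b \<otimes>\<^bsub>A\<^esub> b) \<otimes>\<^bsub>A\<^esub> (d \<otimes>\<^bsub>A\<^esub> d)))\<rparr>"

definition poisson_center :: "'a poisson_alg \<Rightarrow> 'a set" where
  "poisson_center B = {a \<in> carrier B. \<forall>b\<in>carrier B. \<lbrace>a, b\<rbrace>\<^bsub>B\<^esub> = \<zero>\<^bsub>B\<^esub>}"

definition poisson_rational :: "'a poisson_alg \<Rightarrow> 'a set \<Rightarrow> bool" where
  "poisson_rational A P \<longleftrightarrow>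
    (let K = poisson_frac (poisson_quot A P)
     in poisson_center K = range (\<lambda>c. c \<odot>\<^bsub>K\<^esub> \<one>\<^bsub>K\<^esub>))"


section \<open>The Poisson Dixmier--Moeglin equivalence\<close>

definition poisson_dixmier_moeglin :: "'a poisson_alg \<Rightarrow> bool" where
  "poisson_dixmier_moeglin A \<longleftrightarrow>
    {P \<in> poisson_spec A. locally_closed_in (poisson_spec_topology A) {P}} =
      {P. poisson_primitive A P} \<and>
    {P. poisson_primitive A P} = {P \<in> poisson_spec A. poisson_rational A P}"


section \<open>Well-definedness\<close>

lemma istopology_zariski:
  "istopology (\<lambda>U. \<exists>S\<subseteq>carrier R. U = {P. primeideal P R} - {P. primeideal P R \<and> S \<subseteq> P})"
  unfolding istopology_def
proof (intro conjI allI impI)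
  fix U V
  assume "\<exists>S\<subseteq>carrier R. U = {P. primeideal P R} - {P. primeideal P R \<and> S \<subseteq> P}"
    and "\<exists>S\<subseteq>carrier R. V = {P. primeideal P R} - {P. primeideal P R \<and> S \<subseteq> P}"
  then obtain S T where S: "S \<subseteq> carrier R" "U = {P. primeideal P R} - {P. primeideal P R \<and> S \<subseteq> P}"
    and T: "T \<subseteq> carrier R" "V = {P. primeideal P R} - {P. primeideal P R \<and> T \<subseteq> P}"
    by blast
  let ?W = "carrier R \<inter> {s \<otimes>\<^bsub>R\<^esub> t | s t. s \<in> S \<and> t \<in> T}"
  have "?W \<subseteq> P \<longleftrightarrow> S \<subseteq> P \<or> T \<subseteq> P" if P: "primeideal P R" for P
  proof -
    interpret primeideal P R by fact
    show ?thesis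
    proof
      assume W: "?W \<subseteq> P"
      show "S \<subseteq> P \<or> T \<subseteq> P"
      proof (rule ccontr)
        assume "\<not> (S \<subseteq> P \<or> T \<subseteq> P)"
        then obtain s t where st: "s \<in> S" "s \<notin> P" "t \<in> T" "t \<notin> P" by blast
        with S(1) T(1) have "s \<in> carrier R" "t \<in> carrier R" by auto
        with st W have "s \<otimes>\<^bsub>R\<^esub> t \<in> P" by blast
        with I_prime \<open>s \<in> carrier R\<close> \<open>t \<in> carrier R\<close> st show False by blast
      qed
    next
      assume "S \<subseteq> P \<or> T \<subseteq> P"
      then show "?W \<subseteq> P" using S(1) T(1) I_l_closed I_r_closed by blast
    qed
  qed
  then have "U \<inter> V = {P. primeideal P R} - {P. primeideal P R \<and> ?W \<subseteq> P}"
    using S T by blast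
  then show "\<exists>S\<subseteq>carrier R. U \<inter> V = {P. primeideal P R} - {P. primeideal P R \<and> S \<subseteq> P}"
    by blast
next
  fix \<K>
  assume "\<forall>K\<in>\<K>. \<exists>S\<subseteq>carrier R. K = {P. primeideal P R} - {P. primeideal P R \<and> S \<subseteq> P}"
  from bchoice[OF this] obtain S where S:
    "\<forall>K\<in>\<K>. S K \<subseteq> carrier R \<and> K = {P. primeideal P R} - {P. primeideal P R \<and> S K \<subseteq> P}" ..
  have "\<Union>\<K> = (\<Union>K\<in>\<K>. {P. primeideal P R} - {P. primeideal P R \<and> S K \<subseteq> P})"
    using SUP_cong[OF refl, of \<K> "\<lambda>K. K" "\<lambda>K. {P. primeideal P R} - {P. primeideal P R \<and> S K \<subseteq> P}"] S
    by (simp only: image_ident)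
  also have "\<dots> = {P. primeideal P R} - {P. primeideal P R \<and> (\<Union>K\<in>\<K>. S K) \<subseteq> P}"
    by (simp add: set_eq_iff UN_subset_iff) blast
  finally have "\<Union>\<K> = {P. primeideal P R} - {P. primeideal P R \<and> (\<Union>K\<in>\<K>. S K) \<subseteq> P}" .
  moreover have "(\<Union>K\<in>\<K>. S K) \<subseteq> carrier R" by (rule UN_least) (use S in simp)
  ultimately show "\<exists>S\<subseteq>carrier R. \<Union>\<K> = {P. primeideal P R} - {P. primeideal P R \<and> S \<subseteq> P}"
    by blast
qed

lemma openin_zariski:
  "openin (zariski_topology R) U \<longleftrightarrow>
    (\<exists>S\<subseteq>carrier R. U = {P. primeideal P R} - {P. primeideal P R \<and> S \<subseteq> P})"
  unfolding zariski_topology_def by (simp add: topology_inverse'[OF istopology_zariski])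

lemma topspace_zariski: "topspace (zariski_topology R) = {P. primeideal P R}"
proof
  show "topspace (zariski_topology R) \<subseteq> {P. primeideal P R}"
    unfolding topspace_def by (auto simp: openin_zariski)
  have "P \<notin> {P. primeideal P R \<and> carrier R \<subseteq> P}" if "primeideal P R" for P
  proof -
    interpret primeideal P R by fact
    show ?thesis using I_notcarr a_subset by blast
  qed
  then have "openin (zariski_topology R) {P. primeideal P R}"
    unfolding openin_zariski by (intro exI[of _ "carrier R"]) auto
  then show "{P. primeideal P R} \<subseteq> topspace (zariski_topology R)"
    by (rule openin_subset)
qed

lemma topspace_poisson_spec: "topspace (poisson_spec_topology A) = poisson_spec A"
  by (auto simp: poisson_spec_topology_def topspace_zariski poisson_spec_def)

lemma UN2_const_eq:
  assumes "x \<in> U" "y \<in> V" "\<And>u v. u \<in> U \<Longrightarrow> v \<in> V \<Longrightarrow> f u v = C"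
  shows "(\<Union>u\<in>U. \<Union>v\<in>V. f u v) = C"
  using assms by auto

context poisson_algebra
begin

lemma poisson_ideal_sum:
  assumes "poisson_ideal A I" "poisson_ideal A J"
  shows "poisson_ideal A (I <+> J)"
proof -
  interpret I: ideal I A using assms(1) by (simp add: poisson_ideal_def)
  interpret J: ideal J A using assms(2) by (simp add: poisson_ideal_def)
  have "\<lbrace>x \<oplus> y, z\<rbrace> \<in> I <+> J" if "x \<in> I" "y \<in> J" "z \<in> carrier A" for x y z
  proof -
    have "\<lbrace>x \<oplus> y, z\<rbrace> = \<lbrace>x, z\<rbrace> \<oplus> \<lbrace>y, z\<rbrace>"
      using that by (simp add: pbracket_add_left I.a_Hcarr J.a_Hcarr)
    moreover have "\<lbrace>x, z\<rbrace> \<in> I" "\<lbrace>y, z\<rbrace> \<in> J" using assms that by (auto simp: poisson_ideal_def)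
    ultimately show ?thesis by (auto simp: set_add_def')
  qed
  then show ?thesis
    unfolding poisson_ideal_def using add_ideals[OF I.ideal_axioms J.ideal_axioms]
    by (auto simp: set_add_def')
qed

lemma poisson_core:
  assumes "ideal J A"
  shows "poisson_ideal A (poisson_core A J)" "poisson_core A J \<subseteq> J"
    "\<And>I. poisson_ideal A I \<Longrightarrow> I \<subseteq> J \<Longrightarrow> I \<subseteq> poisson_core A J"
proof -
  interpret J: ideal J A by fact
  define C where "C = \<Union>{I. poisson_ideal A I \<and> I \<subseteq> J}"
  have "\<lbrace>\<zero>, y\<rbrace> = \<zero>" if "y \<in> carrier A" for y
    using pbracket_add_left[of \<zero> \<zero> y] that by (simp add: M.add.l_cancel_one)
  then have zero: "poisson_ideal A {\<zero>}"
    by (simp add: poisson_ideal_def ring.zeroideal[OF cring.axioms(1)[OF M_cring]])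
  have sum: "I <+> K \<subseteq> J" if "I \<subseteq> J" "K \<subseteq> J" for I K
    using that by (auto simp: set_add_def')
  have "ideal C A"
  proof (rule idealI)
    show "ring A" by (rule cring.axioms(1)[OF M_cring])
    show "subgroup C (add_monoid A)"
    proof (rule M.add.subgroupI)
      show "C \<subseteq> carrier A" using J.a_subset by (auto simp: C_def)
      show "C \<noteq> {}" using zero J.zero_closed by (auto simp: C_def)
    next
      fix x assume "x \<in> C"
      then obtain I where I: "x \<in> I" "poisson_ideal A I" "I \<subseteq> J" by (auto simp: C_def)
      then interpret I: ideal I A by (simp add: poisson_ideal_def)
      have "\<ominus> x \<in> I" using I(1) by simp
      then show "\<ominus> x \<in> C" using I by (auto simp: C_def)
    next
      fix x y assume "x \<in> C" "y \<in> C"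
      then obtain I K where "x \<in> I" "poisson_ideal A I" "I \<subseteq> J"
        "y \<in> K" "poisson_ideal A K" "K \<subseteq> J" by (auto simp: C_def)
      then have "x \<oplus> y \<in> I <+> K" "poisson_ideal A (I <+> K)" "I <+> K \<subseteq> J"
        using poisson_ideal_sum sum by (auto simp: set_add_def')
      then show "x \<oplus> y \<in> C" by (auto simp: C_def)
    qed
  next
    fix a x assume "a \<in> C" "x \<in> carrier A"
    then obtain I where I: "a \<in> I" "poisson_ideal A I" "I \<subseteq> J" by (auto simp: C_def)
    then interpret I: ideal I A by (simp add: poisson_ideal_def)
    show "x \<otimes> a \<in> C" using I \<open>x \<in> carrier A\<close> I.I_l_closed by (auto simp: C_def)
    show "a \<otimes> x \<in> C" using I \<open>x \<in> carrier A\<close> I.I_r_closed by (auto simp: C_def)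
  qed
  then have C: "poisson_ideal A C \<and> C \<subseteq> J"
    by (auto simp: poisson_ideal_def C_def)
  then have "poisson_core A J = C"
    unfolding poisson_core_def by (intro Greatest_equality) (auto simp: C_def)
  with C show "poisson_ideal A (poisson_core A J)" "poisson_core A J \<subseteq> J"
    "\<And>I. poisson_ideal A I \<Longrightarrow> I \<subseteq> J \<Longrightarrow> I \<subseteq> poisson_core A J"
    by (auto simp: C_def)
qed

lemma pbracket_quot:
  assumes I: "poisson_ideal A I" and x: "x \<in> carrier A" and y: "y \<in> carrier A"
  shows "\<lbrace>I +> x, I +> y\<rbrace>\<^bsub>poisson_quot A I\<^esub> = I +> \<lbrace>x, y\<rbrace>"
proof -
  interpret I: ideal I A using I by (simp add: poisson_ideal_def)
  have br: "\<lbrace>i, z\<rbrace> \<in> I" "\<lbrace>z, i\<rbrace> \<in> I" if "i \<in> I" "z \<in> carrier A" for i z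
  proof -
    show 1: "\<lbrace>i, z\<rbrace> \<in> I" using I that by (auto simp: poisson_ideal_def)
    have i: "i \<in> carrier A" using that I.a_Hcarr by blast
    have "\<zero> = \<lbrace>i \<oplus> z, i \<oplus> z\<rbrace>" using i that by simp
    also have "\<dots> = (\<lbrace>i, i\<rbrace> \<oplus> \<lbrace>i, z\<rbrace>) \<oplus> (\<lbrace>z, i\<rbrace> \<oplus> \<lbrace>z, z\<rbrace>)"
      using i that by (simp add: pbracket_add_left pbracket_add_right M.a_ac del: pbracket_alternating)
    also have "\<dots> = \<lbrace>i, z\<rbrace> \<oplus> \<lbrace>z, i\<rbrace>" using i that by simp
    finally have "\<lbrace>i, z\<rbrace> \<oplus> \<lbrace>z, i\<rbrace> = \<zero>" by simp
    then have "\<lbrace>z, i\<rbrace> = \<ominus> \<lbrace>i, z\<rbrace>"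
      using i that by (metis M.add.inv_equality M.a_comm M.minus_equality pbracket_closed)
    then show "\<lbrace>z, i\<rbrace> \<in> I" using 1 by simp
  qed
  have eq: "I +> \<lbrace>x', y'\<rbrace> = I +> \<lbrace>x, y\<rbrace>" if x'y': "x' \<in> I +> x" "y' \<in> I +> y" for x' y'
  proof -
    obtain i j where ij: "i \<in> I" "x' = i \<oplus> x" "j \<in> I" "y' = j \<oplus> y"
      using x'y' by (auto simp: a_r_coset_def r_coset_def)
    note c = I.a_Hcarr[OF ij(1)] I.a_Hcarr[OF ij(3)]
    have "\<lbrace>x', y'\<rbrace> = (\<lbrace>i, j\<rbrace> \<oplus> \<lbrace>i, y\<rbrace> \<oplus> \<lbrace>x, j\<rbrace>) \<oplus> \<lbrace>x, y\<rbrace>"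
      using ij c x y by (simp add: pbracket_add_left pbracket_add_right M.a_ac)
    moreover have "\<lbrace>i, j\<rbrace> \<oplus> \<lbrace>i, y\<rbrace> \<oplus> \<lbrace>x, j\<rbrace> \<in> I"
      using ij c x y br by simp
    ultimately have "\<lbrace>x', y'\<rbrace> \<in> I +> \<lbrace>x, y\<rbrace>" by (auto simp: a_r_coset_def r_coset_def)
    then show ?thesis using x y I.a_subgroup by (intro M.a_repr_independence[symmetric]) auto
  qed
  have "x \<in> I +> x" "y \<in> I +> y" using x y I.a_rcos_self by auto
  then show ?thesis
    unfolding poisson_quot_def poisson_alg.simps by (rule UN2_const_eq) (rule eq)
qed

end

lemma (in domain) equiv_frac_rel: "equiv (carrier R \<times> (carrier R - {\<zero>})) (frac_rel R)"
proof (rule equivI)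
  show "frac_rel R \<subseteq> (carrier R \<times> (carrier R - {\<zero>})) \<times> (carrier R \<times> (carrier R - {\<zero>}))"
    by (auto simp: frac_rel_def)
  show "refl_on (carrier R \<times> (carrier R - {\<zero>})) (frac_rel R)"
    by (auto simp: refl_on_def frac_rel_def)
  show "sym (frac_rel R)" by (auto simp: sym_def frac_rel_def)
  show "trans (frac_rel R)"
  proof (rule transI, clarsimp simp: frac_rel_def)
    fix a b c d e f
    assume c: "a \<in> carrier R" "b \<in> carrier R" "c \<in> carrier R" "d \<in> carrier R" "e \<in> carrier R"
      "f \<in> carrier R" and nz: "d \<noteq> \<zero>" and eq: "a \<otimes> d = c \<otimes> b" "c \<otimes> f = e \<otimes> d"
    have "d \<otimes> (a \<otimes> f) = (a \<otimes> d) \<otimes> f" using c by algebra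
    also have "\<dots> = (c \<otimes> f) \<otimes> b" unfolding eq(1) using c by algebra
    also have "\<dots> = d \<otimes> (e \<otimes> b)" unfolding eq(2) using c by algebra
    finally show "a \<otimes> f = e \<otimes> b" using c nz by (simp add: m_lcancel)
  qed
qed

lemma (in domain) fraction_eq_iff:
  assumes "a \<in> carrier R" "b \<in> carrier R - {\<zero>}" "c \<in> carrier R" "d \<in> carrier R - {\<zero>}"
  shows "fraction R a b = fraction R c d \<longleftrightarrow> a \<otimes> d = c \<otimes> b"
  unfolding fraction_def
  using eq_equiv_class_iff[OF equiv_frac_rel, of "(a, b)" "(c, d)"] assms
  by (auto simp: frac_rel_def)

lemma (in cring) quotient_rule_cong:
  assumes c: "a \<in> carrier R" "b \<in> carrier R" "a' \<in> carrier R" "b' \<in> carrier R"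
      "p \<in> carrier R" "q \<in> carrier R" "p' \<in> carrier R" "q' \<in> carrier R"
    and eq: "a \<otimes> b' = a' \<otimes> b"
    and der: "a \<otimes> q' \<oplus> b' \<otimes> p = a' \<otimes> q \<oplus> b \<otimes> p'"
  shows "(b \<otimes> p \<ominus> a \<otimes> q) \<otimes> (b' \<otimes> b') = (b' \<otimes> p' \<ominus> a' \<otimes> q') \<otimes> (b \<otimes> b)"
proof -
  have "(b \<otimes> p \<ominus> a \<otimes> q) \<otimes> (b' \<otimes> b')
      = b \<otimes> b' \<otimes> ((a \<otimes> q' \<oplus> b' \<otimes> p) \<ominus> a \<otimes> q') \<ominus> (a \<otimes> b') \<otimes> (q \<otimes> b')"
    using c by algebra
  also have "\<dots> = b \<otimes> b' \<otimes> ((a' \<otimes> q \<oplus> b \<otimes> p') \<ominus> a \<otimes> q') \<ominus> (a' \<otimes> b) \<otimes> (q \<otimes> b')"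
    by (simp only: eq der)
  also have "\<dots> = b \<otimes> b \<otimes> b' \<otimes> p' \<ominus> b \<otimes> (a \<otimes> b') \<otimes> q'"
    using c by algebra
  also have "\<dots> = b \<otimes> b \<otimes> b' \<otimes> p' \<ominus> b \<otimes> (a' \<otimes> b) \<otimes> q'" by (simp only: eq)
  also have "\<dots> = (b' \<otimes> p' \<ominus> a' \<otimes> q') \<otimes> (b \<otimes> b)" using c by algebra
  finally show ?thesis .
qed

lemma (in poisson_algebra) pbracket_frac:
  assumes dom: "domain A"
    and ab: "a \<in> carrier A" "b \<in> carrier A - {\<zero>}"
    and cd: "c \<in> carrier A" "d \<in> carrier A - {\<zero>}"
  shows "\<lbrace>fraction A a b, fraction A c d\<rbrace>\<^bsub>poisson_frac A\<^esub> =
    fraction A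
      (d \<otimes> (b \<otimes> \<lbrace>a, c\<rbrace> \<ominus> a \<otimes> \<lbrace>b, c\<rbrace>) \<ominus> c \<otimes> (b \<otimes> \<lbrace>a, d\<rbrace> \<ominus> a \<otimes> \<lbrace>b, d\<rbrace>))
      ((b \<otimes> b) \<otimes> (d \<otimes> d))" (is "_ = fraction A (?N a b c d) (?D b d)")
proof -
  interpret D: domain A by fact
  have eq: "fraction A (?N a' b' c' d') (?D b' d') = fraction A (?N a b c d) (?D b d)"
    if "(a', b') \<in> fraction A a b" "(c', d') \<in> fraction A c d" for a' b' c' d'
  proof -
    have c': "a' \<in> carrier A" "b' \<in> carrier A" "c' \<in> carrier A" "d' \<in> carrier A"
      and nz: "b' \<noteq> \<zero>" "d' \<noteq> \<zero>"
      and e1: "a \<otimes> b' = a' \<otimes> b" and e2: "c \<otimes> d' = c' \<otimes> d"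
      using that by (auto simp: fraction_def frac_rel_def)
    have cc: "a \<in> carrier A" "b \<in> carrier A" "c \<in> carrier A" "d \<in> carrier A"
      using ab cd by auto
    have left: "(b \<otimes> \<lbrace>a, y\<rbrace> \<ominus> a \<otimes> \<lbrace>b, y\<rbrace>) \<otimes> (b' \<otimes> b') =
        (b' \<otimes> \<lbrace>a', y\<rbrace> \<ominus> a' \<otimes> \<lbrace>b', y\<rbrace>) \<otimes> (b \<otimes> b)" if "y \<in> carrier A" for y
    proof (rule cring.quotient_rule_cong[OF M_cring])
      show "a \<otimes> \<lbrace>b', y\<rbrace> \<oplus> b' \<otimes> \<lbrace>a, y\<rbrace> = a' \<otimes> \<lbrace>b, y\<rbrace> \<oplus> b \<otimes> \<lbrace>a', y\<rbrace>"
        using c' cc that e1 by (simp flip: pbracket_Leibniz_left)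
    qed (use c' cc that e1 in auto)
    have right: "(d \<otimes> \<lbrace>x, c\<rbrace> \<ominus> c \<otimes> \<lbrace>x, d\<rbrace>) \<otimes> (d' \<otimes> d') =
        (d' \<otimes> \<lbrace>x, c'\<rbrace> \<ominus> c' \<otimes> \<lbrace>x, d'\<rbrace>) \<otimes> (d \<otimes> d)" if "x \<in> carrier A" for x
    proof (rule cring.quotient_rule_cong[OF M_cring])
      show "c \<otimes> \<lbrace>x, d'\<rbrace> \<oplus> d' \<otimes> \<lbrace>x, c\<rbrace> = c' \<otimes> \<lbrace>x, d\<rbrace> \<oplus> d \<otimes> \<lbrace>x, c'\<rbrace>"
        using c' cc that e2 by (simp flip: pbracket_Leibniz_right)
    qed (use c' cc that e2 in auto)
    have swap: "?N u v w z = v \<otimes> (z \<otimes> \<lbrace>u, w\<rbrace> \<ominus> w \<otimes> \<lbrace>u, z\<rbrace>) \<ominus> u \<otimes> (z \<otimes> \<lbrace>v, w\<rbrace> \<ominus> w \<otimes> \<lbrace>v, z\<rbrace>)"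
      if "u \<in> carrier A" "v \<in> carrier A" "w \<in> carrier A" "z \<in> carrier A" for u v w z
    proof -
      have "\<lbrace>u, w\<rbrace> \<in> carrier A" "\<lbrace>u, z\<rbrace> \<in> carrier A" "\<lbrace>v, w\<rbrace> \<in> carrier A" "\<lbrace>v, z\<rbrace> \<in> carrier A"
        using that by auto
      with that show ?thesis by algebra
    qed
    have pull: "(x \<otimes> u \<ominus> y \<otimes> v) \<otimes> w = x \<otimes> (u \<otimes> w) \<ominus> y \<otimes> (v \<otimes> w)"
      if "x \<in> carrier A" "y \<in> carrier A" "u \<in> carrier A" "v \<in> carrier A" "w \<in> carrier A"
      for x y u v w
      using that by algebra
    have N: "?N u v w z \<in> carrier A"
      if "u \<in> carrier A" "v \<in> carrier A" "w \<in> carrier A" "z \<in> carrier A" for u v w z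
      using that by simp
    have 1: "?N a b c d \<otimes> (b' \<otimes> b') = ?N a' b' c d \<otimes> (b \<otimes> b)"
      using pull[of d c "b \<otimes> \<lbrace>a, c\<rbrace> \<ominus> a \<otimes> \<lbrace>b, c\<rbrace>" "b \<otimes> \<lbrace>a, d\<rbrace> \<ominus> a \<otimes> \<lbrace>b, d\<rbrace>" "b' \<otimes> b'"]
        pull[of d c "b' \<otimes> \<lbrace>a', c\<rbrace> \<ominus> a' \<otimes> \<lbrace>b', c\<rbrace>" "b' \<otimes> \<lbrace>a', d\<rbrace> \<ominus> a' \<otimes> \<lbrace>b', d\<rbrace>" "b \<otimes> b"]
        left[of c] left[of d] c' cc by simp
    have 2: "?N a' b' c d \<otimes> (d' \<otimes> d') = ?N a' b' c' d' \<otimes> (d \<otimes> d)"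
      using pull[of b' a' "d \<otimes> \<lbrace>a', c\<rbrace> \<ominus> c \<otimes> \<lbrace>a', d\<rbrace>" "d \<otimes> \<lbrace>b', c\<rbrace> \<ominus> c \<otimes> \<lbrace>b', d\<rbrace>" "d' \<otimes> d'"]
        pull[of b' a' "d' \<otimes> \<lbrace>a', c'\<rbrace> \<ominus> c' \<otimes> \<lbrace>a', d'\<rbrace>" "d' \<otimes> \<lbrace>b', c'\<rbrace> \<ominus> c' \<otimes> \<lbrace>b', d'\<rbrace>" "d \<otimes> d"]
        right[of a'] right[of b'] swap[of a' b' c d] swap[of a' b' c' d'] c' cc by simp
    have assoc: "n \<otimes> (x \<otimes> y) = n \<otimes> x \<otimes> y" "n \<otimes> x \<otimes> y = n \<otimes> y \<otimes> x"
      if "n \<in> carrier A" "x \<in> carrier A" "y \<in> carrier A" for n x y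
      using that by algebra+
    have "?N a b c d \<otimes> ?D b' d' = ?N a b c d \<otimes> (b' \<otimes> b') \<otimes> (d' \<otimes> d')"
      using c' cc by (intro assoc(1) N) auto
    also have "\<dots> = ?N a' b' c d \<otimes> (b \<otimes> b) \<otimes> (d' \<otimes> d')" by (simp only: 1)
    also have "\<dots> = ?N a' b' c d \<otimes> (d' \<otimes> d') \<otimes> (b \<otimes> b)"
      using c' cc by (intro assoc(2) N) auto
    also have "\<dots> = ?N a' b' c' d' \<otimes> (d \<otimes> d) \<otimes> (b \<otimes> b)" by (simp only: 2)
    also have "\<dots> = ?N a' b' c' d' \<otimes> (b \<otimes> b) \<otimes> (d \<otimes> d)"
      using c' cc by (intro assoc(2) N) auto
    also have "\<dots> = ?N a' b' c' d' \<otimes> ?D b d"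
      using c' cc by (intro assoc(1)[symmetric] N) auto
    finally have "?N a b c d \<otimes> ?D b' d' = ?N a' b' c' d' \<otimes> ?D b d" .
    moreover have "?D b' d' \<in> carrier A - {\<zero>}" "?D b d \<in> carrier A - {\<zero>}"
      using ab cd c' nz by (simp_all add: D.integral_iff)
    ultimately show ?thesis
      using D.fraction_eq_iff[OF N _ N] cc c' by simp
  qed
  have "(a, b) \<in> fraction A a b" "(c, d) \<in> fraction A c d"
    using ab cd by (auto simp: fraction_def frac_rel_def)
  then show ?thesis
    unfolding poisson_frac_def poisson_alg.simps case_prod_beta
    by (rule UN2_const_eq) (rule eq; simp)
qed

lemma (in poisson_algebra) pbracket_frac_one:
  assumes "domain A" and a: "a \<in> carrier A" and c: "c \<in> carrier A"
  shows "\<lbrace>fraction A a \<one>, fraction A c \<one>\<rbrace>\<^bsub>poisson_frac A\<^esub> = fraction A \<lbrace>a, c\<rbrace> \<one>"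
proof -
  interpret D: domain A by fact
  have one: "\<lbrace>\<one>, x\<rbrace> = \<zero>" "\<lbrace>x, \<one>\<rbrace> = \<zero>" if "x \<in> carrier A" for x
    using pbracket_Leibniz_left[of \<one> \<one> x] pbracket_Leibniz_right[of x \<one> \<one>] that
    by (simp_all add: M.add.l_cancel_one)
  show ?thesis
    using pbracket_frac[OF assms(1) a _ c, of \<one> \<one>] a c D.one_not_zero
    by (simp add: one a_minus_def)
qed

end

theory Submission
  imports Defs "HOL-Computational_Algebra.Fundamental_Theorem_Algebra"
    "HOL-Analysis.Continuum_Not_Denumerable"
begin

text \<open>The equivalence is a property of the topological space \<open>P.spec A\<close> alone: it holds iff every
  Poisson prime \<open>P\<close> such that \<open>{P}\<close> is the intersection of a closed set and countably many open
  sets is locally closed. This property passes to locally closed pieces and back.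

  The condition on \<open>P\<close> is equivalent to \<open>P\<close> being primitive and to \<open>P\<close> being rational. If \<open>P\<close> is
  rational, a Jacobson density argument yields, for each member of an exhaustion of \<open>A\<close> by
  finite-dimensional subspaces \<open>V\<close>, an element \<open>w\<close> outside \<open>P\<close> such that every Poisson ideal \<open>Q\<close>
  above \<open>P\<close> that meets \<open>V\<close> outside \<open>P\<close> contains \<open>w\<close>; so countably many open sets separate \<open>P\<close> from the
  Poisson primes strictly above it. Conversely, given countably many open neighbourhoods of \<open>P\<close>,
  some maximal ideal above \<open>P\<close> avoids countably many given elements outside \<open>P\<close>, because the complex
  numbers are uncountable, and the core of that maximal ideal is \<open>P\<close>. That
  primitive ideals are rational follows by evaluating a central fraction at the maximal ideal.\<close>

section \<open>Ideals of commutative rings through closure conditions\<close>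

lemma (in cring) ideal_iff_closed:
  "ideal I R \<longleftrightarrow> I \<subseteq> carrier R \<and> \<zero> \<in> I \<and> (\<forall>x\<in>I. \<forall>y\<in>I. x \<oplus> y \<in> I) \<and> (\<forall>r\<in>carrier R. \<forall>x\<in>I. r \<otimes> x \<in> I)"
  (is "_ \<longleftrightarrow> ?rhs")
proof
  assume "ideal I R"
  then interpret ideal I R .
  show ?rhs using a_subset I_l_closed by auto
next
  assume rhs: ?rhs
  have neg: "\<ominus> x \<in> I" if "x \<in> I" for x
    using rhs that by (metis l_minus l_one one_closed a_inv_closed subsetD)
  show "ideal I R"
  proof (rule idealI)
    show "subgroup I (add_monoid R)"
      using rhs neg by (intro add.subgroupI) (auto simp flip: a_inv_def)
    show "x \<otimes> a \<in> I" "a \<otimes> x \<in> I" if "a \<in> I" "x \<in> carrier R" for a x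
      using rhs that m_comm[of a x] by auto
  qed (rule ring_axioms)
qed

lemma (in ideal) minus_closed: "x \<in> I \<Longrightarrow> y \<in> I \<Longrightarrow> x \<ominus> y \<in> I"
  by (simp add: a_minus_def)

lemma (in ideal) minus_mem_iff:
  assumes "x \<in> carrier R" "y \<in> carrier R" "x \<ominus> y \<in> I"
  shows "x \<in> I \<longleftrightarrow> y \<in> I"
proof -
  have "x = (x \<ominus> y) \<oplus> y" "y = x \<ominus> (x \<ominus> y)"
    using assms(1,2) by algebra+
  then show ?thesis
    using assms(3) additive_subgroup.a_closed[OF is_additive_subgroup] minus_closed by metis
qed

lemma (in primeideal) one_notin: "\<one> \<notin> I"
  using I_notcarr one_imp_carrier by blast

section \<open>Commutative algebras over the complex numbers\<close>

text \<open>The algebra structure is given by the structure map \<open>sc\<close> from the complex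
  numbers, so that scalar multiplication becomes multiplication inside \<open>R\<close>.\<close>

locale complex_algebra = cring R for R :: "('a, 'm) ring_scheme" (structure) +
  fixes sc :: "complex \<Rightarrow> 'a"
  assumes sc_closed [simp, intro]: "sc c \<in> carrier R"
    and sc_add: "sc (a + b) = sc a \<oplus> sc b"
    and sc_mult: "sc (a * b) = sc a \<otimes> sc b"
    and sc_one [simp]: "sc 1 = \<one>"
begin

lemma sc_zero [simp]: "sc 0 = \<zero>"
  using sc_add[of 0 0] add.l_cancel_one[of "sc 0" "sc 0"] by simp

lemma sc_minus: "sc (- c) = \<ominus> sc c"
  using sc_add[of "- c" c] by (simp add: minus_equality[symmetric])

text \<open>Nonzero scalars are units of \<open>R\<close>, with inverse
  \<open>sc (1 / c)\<close>.\<close>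

lemma sc_mult_mem_iff:
  assumes "ideal I R" "c \<noteq> 0" "x \<in> carrier R"
  shows "sc c \<otimes> x \<in> I \<longleftrightarrow> x \<in> I"
proof
  interpret I: ideal I R by fact
  show "x \<in> I \<Longrightarrow> sc c \<otimes> x \<in> I" by (simp add: I.I_l_closed)
  assume "sc c \<otimes> x \<in> I"
  then have "sc (1 / c) \<otimes> (sc c \<otimes> x) \<in> I" by (simp add: I.I_l_closed)
  then show "x \<in> I" using assms by (simp flip: m_assoc sc_mult)
qed

text \<open>Horner's scheme for the evaluation homomorphism at \<open>a\<close>; the coefficients
  are complex numbers and the value lies in \<open>R\<close>.\<close>

definition peval :: "'a \<Rightarrow> complex poly \<Rightarrow> 'a" where
  "peval a p = fold_coeffs (\<lambda>c v. sc c \<oplus> a \<otimes> v) p \<zero>"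

lemma peval_0 [simp]: "peval a 0 = \<zero>"
  by (simp add: peval_def)

lemma peval_pCons [simp]:
  assumes "a \<in> carrier R"
  shows "peval a (pCons c p) = sc c \<oplus> a \<otimes> peval a p"
  using assms by (cases "p = 0 \<and> c = 0") (auto simp: peval_def)

context
  fixes a assumes a [simp]: "a \<in> carrier R"
begin

lemma peval_closed [simp]: "peval a p \<in> carrier R"
  by (induction p) auto

lemma peval_add: "peval a (p + q) = peval a p \<oplus> peval a q"
proof (induction p q rule: poly_induct2)
  case (pCons c p d q)
  have "sc c \<oplus> sc d \<oplus> a \<otimes> (peval a p \<oplus> peval a q) =
      sc c \<oplus> a \<otimes> peval a p \<oplus> (sc d \<oplus> a \<otimes> peval a q)" if "a \<in> carrier R"
    by (simp add: r_distr a_ac)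
  then show ?case by (simp add: pCons sc_add)
qed auto

lemma peval_smult: "peval a (smult c p) = sc c \<otimes> peval a p"
  by (induction p) (auto simp: sc_mult r_distr m_lcomm)

lemma peval_mult: "peval a (p * q) = peval a p \<otimes> peval a q"
  by (induction p) (auto simp: peval_add peval_smult l_distr m_assoc)

lemma peval_minus: "peval a (p - q) = peval a p \<ominus> peval a q"
  using peval_add[of p "- q"] peval_smult[of "-1" q] by (simp add: sc_minus a_minus_def l_minus)

lemma peval_linear: "peval a [:- c, 1:] = a \<ominus> sc c"
  by (simp add: sc_minus a_minus_def a_comm)

text \<open>A nonzero complex polynomial is a product of linear factors and a nonzero constant, and
  by \<open>lin\<close> no linear factor takes a value in the prime \<open>M\<close>. In other
  words, a non-scalar element of \<open>R / M\<close> is transcendental over the complex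
  numbers.\<close>

lemma peval_notin_prime:
  assumes "primeideal M R" and lin: "\<And>c. a \<ominus> sc c \<notin> M" and "p \<noteq> 0"
  shows "peval a p \<notin> M"
  using \<open>p \<noteq> 0\<close>
proof (induction "degree p" arbitrary: p rule: less_induct)
  case less
  interpret M: primeideal M R by fact
  show ?case
  proof (cases "degree p = 0")
    case True
    then obtain c where "p = [:c:]" by (metis degree_eq_zeroE)
    then show ?thesis
      using less.prems sc_mult_mem_iff[OF M.is_ideal, of c \<one>] M.one_notin by auto
  next
    case False
    then have "\<not> constant (poly p)" by (simp add: constant_degree)
    then obtain z where "poly p z = 0" using fundamental_theorem_of_algebra by blast
    then obtain q where q: "p = [:- z, 1:] * q" by (metis dvdE poly_eq_0_iff_dvd)
    then have "q \<noteq> 0" using less.prems by auto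
    then have "degree q < degree p" unfolding q by (subst degree_mult_eq) auto
    then have "peval a q \<notin> M" using less.hyps \<open>q \<noteq> 0\<close> by blast
    then show ?thesis
      using M.I_prime[of "a \<ominus> sc z" "peval a q"] lin[of z] unfolding q peval_mult peval_linear by auto
  qed
qed

end

text \<open>For an ideal \<open>J\<close>, this is the preimage in \<open>R\<close> of the subspace
  of \<open>R / J\<close> spanned by the classes of \<open>e 0\<close>, ...,
  \<open>e (n - 1)\<close>.\<close>

primrec lspan :: "'a set \<Rightarrow> (nat \<Rightarrow> 'a) \<Rightarrow> nat \<Rightarrow> 'a set" where
  "lspan J e 0 = J"
| "lspan J e (Suc n) = {v \<oplus> sc c \<otimes> e n | v c. v \<in> lspan J e n}"

context
  fixes J and e :: "nat \<Rightarrow> 'a"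
  assumes J: "ideal J R" and e: "range e \<subseteq> carrier R"
begin

interpretation J: ideal J R by (fact J)

private lemma e_closed [simp]: "e n \<in> carrier R"
  using e by blast

lemma lspan_subset: "lspan J e n \<subseteq> carrier R"
  by (induction n) (auto simp: J.a_Hcarr)

lemma lspan_step: "lspan J e n \<subseteq> lspan J e (Suc n)"
proof
  fix x assume "x \<in> lspan J e n"
  moreover from this have "x \<in> carrier R" using lspan_subset by blast
  then have "x = x \<oplus> sc 0 \<otimes> e n" by simp
  ultimately show "x \<in> lspan J e (Suc n)" unfolding lspan.simps by blast
qed

lemma lspan_mono: "m \<le> n \<Longrightarrow> lspan J e m \<subseteq> lspan J e n"
  using lift_Suc_mono_le[of "lspan J e", OF lspan_step] .

lemma subset_lspan: "J \<subseteq> lspan J e n"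
  using lspan_mono[of 0 n] by simp

lemma lspan_add:
  "x \<in> lspan J e n \<Longrightarrow> y \<in> lspan J e n \<Longrightarrow> x \<oplus> y \<in> lspan J e n"
proof (induction n arbitrary: x y)
  case (Suc n)
  then obtain v c w d where *: "x = v \<oplus> sc c \<otimes> e n" "y = w \<oplus> sc d \<otimes> e n"
      "v \<in> lspan J e n" "w \<in> lspan J e n" by auto
  then have "v \<in> carrier R" "w \<in> carrier R" using lspan_subset by auto
  then have "x \<oplus> y = (v \<oplus> w) \<oplus> sc (c + d) \<otimes> e n"
    unfolding * sc_add by (simp add: l_distr a_ac)
  then show ?case using Suc.IH * by auto
qed auto

lemma lspan_scale: "x \<in> lspan J e n \<Longrightarrow> sc k \<otimes> x \<in> lspan J e n"
proof (induction n arbitrary: x)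
  case (Suc n)
  then obtain v c where *: "x = v \<oplus> sc c \<otimes> e n" "v \<in> lspan J e n" by auto
  then have "v \<in> carrier R" using lspan_subset by auto
  then have "sc k \<otimes> x = sc k \<otimes> v \<oplus> sc (k * c) \<otimes> e n"
    unfolding * sc_mult by (simp add: r_distr m_assoc)
  then show ?case using Suc.IH * by auto
qed (simp add: J.I_l_closed)

lemma lspan_minus:
  assumes "x \<in> lspan J e n" "y \<in> lspan J e n"
  shows "x \<ominus> y \<in> lspan J e n"
proof -
  have "x \<ominus> y = x \<oplus> sc (-1) \<otimes> y"
    using assms lspan_subset by (auto simp: sc_minus a_minus_def l_minus subset_eq)
  then show ?thesis using assms lspan_add lspan_scale by metis
qed

lemma basis_in_lspan: "sc c \<otimes> e n \<in> lspan J e (Suc n)"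
proof -
  have "sc c \<otimes> e n = \<zero> \<oplus> sc c \<otimes> e n" by simp
  moreover have "\<zero> \<in> lspan J e n" using subset_lspan J.zero_closed by blast
  ultimately show ?thesis unfolding lspan.simps by blast
qed

end

lemma lspan_zero_subset:
  assumes "ideal J R" shows "lspan {\<zero>} e n \<subseteq> lspan J e n"
  by (induction n) (use additive_subgroup.zero_closed[OF ideal.axioms(1)[OF assms]] in auto)

text \<open>The elements \<open>s / (a - c)\<close> of the fraction field of \<open>R / M\<close> are linearly independent, so that
  only finitely many of them lie in a finite-dimensional subspace. Eliminating \<open>e n\<close> replaces
  them by fractions \<open>s q(a) / ((a - c) g(a))\<close>, where \<open>q(c) \<noteq> 0\<close> says that the pole at \<open>c\<close>
  survives.\<close>

lemma no_infinite_pole_family: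
  assumes M: "primeideal M R" and e: "range e \<subseteq> carrier R"
    and a: "a \<in> carrier R" and lin: "\<And>c. a \<ominus> sc c \<notin> M" and s: "s \<in> carrier R - M"
    and "infinite T" and "\<And>c. c \<in> T \<Longrightarrow> r c \<in> lspan M e n"
    and "\<And>c. c \<in> T \<Longrightarrow> (a \<ominus> sc c) \<otimes> peval a g \<otimes> r c \<ominus> s \<otimes> peval a (q c) \<in> M"
    and "\<And>c. c \<in> T \<Longrightarrow> poly (q c) c \<noteq> 0"
  shows False
  using assms(6-)
proof (induction n arbitrary: T r g q)
  interpret M: primeideal M R by (fact M)
  have [simp]: "e n \<in> carrier R" for n using e by blast
  note [simp] = a
  {
    case 0
    then have "T \<noteq> {}" by auto
    then obtain c where c: "c \<in> T" by blast
    then have r: "r c \<in> M" using 0 by simp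
    \<comment> \<open>For \<open>n = 0\<close> the fraction vanishes modulo \<open>M\<close>, which
      puts \<open>s q(a)\<close> into \<open>M\<close> although neither factor lies there.\<close>
    have "s \<otimes> peval a (q c) \<in> M"
      using M.minus_mem_iff[OF _ _ 0(3)[OF c]] r s by (simp add: M.I_l_closed M.a_Hcarr)
    then have "peval a (q c) \<in> M" using M.I_prime[of s "peval a (q c)"] s by simp
    then have "q c = 0" using peval_notin_prime[OF a M lin] by blast
    then show False using 0(4)[OF c] by simp
  next
    case (Suc n)
    have "\<exists>v l. \<forall>c\<in>T. v c \<in> lspan M e n \<and> r c = v c \<oplus> sc (l c) \<otimes> e n"
      using Suc.prems(2) by (simp, metis)
    then obtain v l where v: "\<And>c. c \<in> T \<Longrightarrow> v c \<in> lspan M e n"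
      and r: "\<And>c. c \<in> T \<Longrightarrow> r c = v c \<oplus> sc (l c) \<otimes> e n" by blast
    have vc: "v c \<in> carrier R" if "c \<in> T" for c
      using v[OF that] lspan_subset[OF M.is_ideal e] by blast
    show False
    proof (cases "\<exists>c\<in>T. l c \<noteq> 0")
      case False
      then have "r c = v c" if "c \<in> T" for c using that r vc by auto
      then show False using Suc.IH[of T r g q] Suc.prems v by auto
    next
      case True
      then obtain c0 where c0: "c0 \<in> T" "l c0 \<noteq> 0" by blast
      \<comment> \<open>Subtracting \<open>m c\<close> times \<open>r c0\<close> from
        \<open>r c\<close> cancels the coefficient of \<open>e n\<close>. Over the common
        denominator, \<open>g\<close> gains the factor \<open>t - c0\<close> and the new numerator
        is \<open>?q c\<close>. At \<open>t = c\<close> its second summand vanishes and the first is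
        \<open>q c\<close> at \<open>c\<close> times \<open>c - c0\<close>, which is nonzero; hence
        \<open>c0\<close> is removed from \<open>T\<close>.\<close>
      define m where "m c = l c / l c0" for c
      let ?T = "T - {c0}" and ?r = "\<lambda>c. r c \<ominus> sc (m c) \<otimes> r c0"
      let ?g = "g * [:- c0, 1:]"
      let ?q = "\<lambda>c. q c * [:- c0, 1:] - smult (m c) (q c0 * [:- c, 1:])"
      show False
      proof (rule Suc.IH[of ?T ?r ?g ?q])
        show "infinite ?T" using Suc.prems(1) by simp
      next
        fix c assume c: "c \<in> ?T"
        then have cT: "c \<in> T" "c \<noteq> c0" by auto
        have lc: "l c = m c * l c0" using c0 by (simp add: m_def)
        have car: "v c \<in> carrier R" "v c0 \<in> carrier R" using vc c0 cT by auto
        have "?r c = (v c \<oplus> (sc (m c) \<otimes> sc (l c0)) \<otimes> e n) \<ominus> sc (m c) \<otimes> (v c0 \<oplus> sc (l c0) \<otimes> e n)"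
          using r cT c0 lc by (simp add: sc_mult)
        also have "\<dots> = v c \<ominus> sc (m c) \<otimes> v c0"
        proof -
          have "sc (m c) \<in> carrier R" "sc (l c0) \<in> carrier R" "e n \<in> carrier R" by auto
          with car show ?thesis by algebra
        qed
        also have "\<dots> \<in> lspan M e n"
          using v cT c0 by (intro lspan_minus lspan_scale M.is_ideal e) auto
        finally show "?r c \<in> lspan M e n" .
        show "poly (?q c) c \<noteq> 0" using Suc.prems(4) cT by simp
        let ?A = "a \<ominus> sc c" and ?B = "a \<ominus> sc c0" and ?G = "peval a g" and ?m = "sc (m c)"
          and ?Q = "peval a (q c)" and ?Z = "peval a (q c0)"
        have "?A \<otimes> peval a ?g \<otimes> ?r c \<ominus> s \<otimes> peval a (?q c) =
            ?A \<otimes> (?G \<otimes> ?B) \<otimes> (r c \<ominus> ?m \<otimes> r c0) \<ominus> s \<otimes> (?Q \<otimes> ?B \<ominus> ?m \<otimes> (?Z \<otimes> ?A))"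
          by (simp only: peval_mult peval_minus peval_smult peval_linear a)
        also have "\<dots> = ?B \<otimes> (?A \<otimes> ?G \<otimes> r c \<ominus> s \<otimes> ?Q) \<ominus> ?m \<otimes> ?A \<otimes> (?B \<otimes> ?G \<otimes> r c0 \<ominus> s \<otimes> ?Z)"
        proof -
          have "?A \<in> carrier R" "?B \<in> carrier R" "?G \<in> carrier R" "?m \<in> carrier R"
            "?Q \<in> carrier R" "?Z \<in> carrier R" "s \<in> carrier R" "r c \<in> carrier R" "r c0 \<in> carrier R"
            using s r cT c0 car by auto
          then show ?thesis by algebra
        qed
        also have "\<dots> \<in> M"
          by (rule M.minus_closed[OF M.I_l_closed M.I_l_closed]) (use Suc.prems(3) cT c0 in simp_all)
        finally show "?A \<otimes> peval a ?g \<otimes> ?r c \<ominus> s \<otimes> peval a (?q c) \<in> M" .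
      qed
    qed
  }
qed

end

section \<open>Ideals that are maximal among those missing a given set\<close>

text \<open>For \<open>S = {\<one>}\<close> these are the maximal ideals of a commutative ring; for
  a multiplicative set \<open>S\<close> they are the contractions of the maximal ideals of the
  localization at \<open>S\<close>.\<close>

definition (in ring) maximal_disjoint :: "'a set \<Rightarrow> 'a set \<Rightarrow> bool" where
  "maximal_disjoint S M \<longleftrightarrow> ideal M R \<and> M \<inter> S = {} \<and>
    (\<forall>J. ideal J R \<longrightarrow> M \<subseteq> J \<longrightarrow> J \<inter> S = {} \<longrightarrow> J = M)"

text \<open>Zorn's lemma: the union of a nonempty chain of ideals missing \<open>S\<close> is an
  ideal missing \<open>S\<close>.\<close>

lemma (in ring) exists_maximal_disjoint:
  assumes "ideal P R" "P \<inter> S = {}"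
  obtains M where "P \<subseteq> M" "maximal_disjoint S M"
proof -
  define F where "F = {I. ideal I R \<and> P \<subseteq> I \<and> I \<inter> S = {}}"
  have "\<exists>M\<in>F. \<forall>J\<in>F. M \<subseteq> J \<longrightarrow> J = M"
  proof (rule subset_Zorn_nonempty)
    show "F \<noteq> {}" using assms unfolding F_def by blast
    fix C assume C: "C \<noteq> {}" "subset.chain F C"
    then have "subset.chain {I. ideal I R} C" unfolding F_def pred_on.chain_def by auto
    then have "ideal (\<Union>C) R" using chain_Union_is_ideal[of C] C(1) by simp
    moreover have "P \<subseteq> \<Union>C" "\<Union>C \<inter> S = {}" using C unfolding F_def pred_on.chain_def by blast+
    ultimately show "\<Union>C \<in> F" unfolding F_def by blast
  qed
  then obtain M where "ideal M R" "P \<subseteq> M" "M \<inter> S = {}" "\<forall>J\<in>F. M \<subseteq> J \<longrightarrow> J = M"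
    unfolding F_def by blast
  then have "P \<subseteq> M" "maximal_disjoint S M" unfolding maximal_disjoint_def F_def by blast+
  then show thesis by (rule that)
qed

text \<open>The ideal \<open>M + R x\<close> is strictly larger than \<open>M\<close>, so it meets
  \<open>S\<close>. If \<open>S\<close> is multiplicative, this says that \<open>r / s\<close> is an
  inverse of \<open>x\<close> in the localization of \<open>R / M\<close> at
  \<open>S\<close>.\<close>

lemma (in cring) maximal_disjoint_witness:
  assumes M: "maximal_disjoint S M" and x: "x \<in> carrier R" "x \<notin> M"
  obtains s r where "s \<in> S" "r \<in> carrier R" "s \<ominus> r \<otimes> x \<in> M"
proof -
  interpret M: ideal M R using M by (simp add: maximal_disjoint_def)
  note Mc = M.a_Hcarr
  let ?J = "{m \<oplus> r \<otimes> x | m r. m \<in> M \<and> r \<in> carrier R}"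
  have "ideal ?J R"
    unfolding ideal_iff_closed
  proof (intro conjI ballI)
    show "?J \<subseteq> carrier R" using x Mc by auto
    have "\<zero> = \<zero> \<oplus> \<zero> \<otimes> x" using x by simp
    then show "\<zero> \<in> ?J" using M.zero_closed by blast
  next
    fix u v assume "u \<in> ?J" "v \<in> ?J"
    then obtain m r m' r' where *: "u = m \<oplus> r \<otimes> x" "v = m' \<oplus> r' \<otimes> x" "m \<in> M" "m' \<in> M"
      "r \<in> carrier R" "r' \<in> carrier R" by blast
    have "u \<oplus> v = (m \<oplus> m') \<oplus> (r \<oplus> r') \<otimes> x"
      using *(1,2) Mc[OF *(3)] Mc[OF *(4)] *(5,6) x(1) by (simp add: l_distr a_ac)
    then show "u \<oplus> v \<in> ?J" using * M.a_closed by blast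
  next
    fix k u assume k: "k \<in> carrier R" and "u \<in> ?J"
    then obtain m r where *: "u = m \<oplus> r \<otimes> x" "m \<in> M" "r \<in> carrier R" by blast
    have "k \<otimes> u = k \<otimes> m \<oplus> (k \<otimes> r) \<otimes> x"
      using *(1) Mc[OF *(2)] *(3) x(1) k by (simp add: r_distr m_assoc)
    moreover have "k \<otimes> m \<in> M" using * k M.I_l_closed by blast
    ultimately show "k \<otimes> u \<in> ?J" using * k m_closed by blast
  qed
  moreover have "M \<subseteq> ?J"
  proof
    fix m assume "m \<in> M"
    moreover from this have "m = m \<oplus> \<zero> \<otimes> x" using Mc x by simp
    ultimately show "m \<in> ?J" by blast
  qed
  moreover have "x = \<zero> \<oplus> \<one> \<otimes> x" using x by simp
  then have "x \<in> ?J" using M.zero_closed by blast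
  ultimately have "?J \<inter> S \<noteq> {}" using M x(2) unfolding maximal_disjoint_def by blast
  then obtain s m r where s: "s \<in> S" "s = m \<oplus> r \<otimes> x" "m \<in> M" "r \<in> carrier R" by blast
  have "s \<ominus> r \<otimes> x = m"
    using s(2) Mc[OF s(3)] s(4) x(1) by (simp add: a_minus_def a_assoc r_neg)
  then show thesis using that s by simp
qed

text \<open>If \<open>x\<close> and \<open>y\<close> lie outside \<open>M\<close>, then modulo
  \<open>M\<close> some \<open>s\<close> and \<open>t\<close> in \<open>S\<close> are multiples of
  \<open>x\<close> and \<open>y\<close>. If \<open>x y\<close> were in \<open>M\<close>, so would be
  \<open>s t\<close>, which is in \<open>S\<close>.\<close>

lemma (in cring) maximal_disjoint_prime:
  assumes M: "maximal_disjoint S M"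
    and S: "S \<subseteq> carrier R" "\<one> \<in> S" "\<And>s t. s \<in> S \<Longrightarrow> t \<in> S \<Longrightarrow> s \<otimes> t \<in> S"
  shows "primeideal M R"
proof (rule primeidealI)
  show "ideal M R" using M by (simp add: maximal_disjoint_def)
  then interpret M: ideal M R .
  show "carrier R \<noteq> M" using M S(2) unfolding maximal_disjoint_def by blast
  fix x y assume xy: "x \<in> carrier R" "y \<in> carrier R" "x \<otimes> y \<in> M"
  show "x \<in> M \<or> y \<in> M"
  proof (rule ccontr)
    assume "\<not> (x \<in> M \<or> y \<in> M)"
    then obtain s r t q where *: "s \<in> S" "r \<in> carrier R" "s \<ominus> r \<otimes> x \<in> M"
        "t \<in> S" "q \<in> carrier R" "t \<ominus> q \<otimes> y \<in> M"
      using maximal_disjoint_witness[OF M xy(1)] maximal_disjoint_witness[OF M xy(2)] by metis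
    have "s \<in> carrier R" "t \<in> carrier R" using * S(1) by auto
    with * xy(1,2) have "s \<otimes> t = t \<otimes> (s \<ominus> r \<otimes> x) \<oplus> r \<otimes> x \<otimes> (t \<ominus> q \<otimes> y) \<oplus> r \<otimes> q \<otimes> (x \<otimes> y)"
      by algebra
    also have "\<dots> \<in> M"
      by (rule M.a_closed[OF M.a_closed[OF M.I_l_closed M.I_l_closed] M.I_l_closed])
        (use * xy \<open>t \<in> carrier R\<close> in auto)
    finally show False using S(3) * M unfolding maximal_disjoint_def by blast
  qed
qed (rule is_cring)

section \<open>Algebras of countable dimension and the Nullstellensatz\<close>

text \<open>Countable dimension over the complex numbers is the form in which finite generation is
  used.\<close>

locale countable_complex_algebra = complex_algebra +
  fixes e :: "nat \<Rightarrow> 'a"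
  assumes e_subset: "range e \<subseteq> carrier R"
    and e_spans: "x \<in> carrier R \<Longrightarrow> \<exists>n. x \<in> lspan {\<zero>} e n"
begin

lemma in_lspan:
  assumes "ideal J R" "x \<in> carrier R"
  obtains n where "x \<in> lspan J e n"
  using e_spans assms lspan_zero_subset by blast

text \<open>Otherwise each \<open>a - c\<close> has a witness \<open>r c\<close> that represents the
  fraction \<open>s c / (a - c)\<close> modulo \<open>M\<close>. There are countably many pairs of
  an element \<open>s c\<close> of \<open>S\<close> and an index \<open>n c\<close> with
  \<open>r c\<close> in \<open>lspan M e (n c)\<close>, but uncountably many \<open>c\<close>. So
  infinitely many \<open>c\<close> share one pair, against
  \<open>no_infinite_pole_family\<close>.\<close>

lemma maximal_disjoint_scalar_residue:
  assumes M: "maximal_disjoint S M" "primeideal M R" and S: "countable S" "S \<subseteq> carrier R"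
    and a: "a \<in> carrier R"
  obtains c where "a \<ominus> sc c \<in> M"
proof (rule ccontr)
  assume "\<not> thesis"
  then have lin: "\<And>c. a \<ominus> sc c \<notin> M" using that by blast
  interpret M: primeideal M R by fact
  have "\<exists>s r n. s \<in> S \<and> r \<in> carrier R \<and> r \<in> lspan M e n \<and> s \<ominus> r \<otimes> (a \<ominus> sc c) \<in> M" for c
    using maximal_disjoint_witness[OF M(1) _ lin[of c]] in_lspan[OF M.is_ideal] a
    by (metis minus_closed sc_closed)
  then obtain s r n where *: "\<And>c. s c \<in> S" "\<And>c. r c \<in> carrier R" "\<And>c. r c \<in> lspan M e (n c)"
    "\<And>c. s c \<ominus> r c \<otimes> (a \<ominus> sc c) \<in> M" by metis
  define f where "f c = (s c, n c)" for c
  have "range f \<subseteq> S \<times> UNIV" using *(1) by (auto simp: f_def)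
  moreover have "countable (S \<times> (UNIV :: nat set))" using S by simp
  ultimately have "countable (range f)" by (rule countable_subset)
  moreover have "(UNIV :: complex set) = (\<Union>y\<in>range f. f -` {y})" by auto
  ultimately obtain y where y: "y \<in> range f" "uncountable (f -` {y})"
    using uncountable_UNIV_complex by (metis countable_UN)
  obtain \<sigma> m where \<sigma>m: "y = (\<sigma>, m)" by (cases y)
  have T: "s c = \<sigma>" "n c = m" if "c \<in> f -` {y}" for c
    using that \<sigma>m by (auto simp: f_def)
  have \<sigma>: "\<sigma> \<in> carrier R - M"
    using y(1) *(1) S(2) M(1) \<sigma>m unfolding maximal_disjoint_def f_def by auto
  \<comment> \<open>On this fibre \<open>r c\<close> is \<open>\<sigma> / (a - c)\<close> modulo
    \<open>M\<close>, which is the case of constant polynomials \<open>g = 1\<close> and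
    \<open>q c = 1\<close>.\<close>
  show False
  proof (rule no_infinite_pole_family[OF M(2) e_subset a lin \<sigma>, of "f -` {y}" r m 1 "\<lambda>_. 1"])
    show "infinite (f -` {y})" using y(2) by (metis countable_finite)
    fix c assume c: "c \<in> f -` {y}"
    show "r c \<in> lspan M e m" using *(3) T[OF c] by metis
    have one: "peval a 1 = \<one>" using peval_pCons[OF a, of 1 0] a by (simp flip: one_pCons)
    have "(a \<ominus> sc c) \<otimes> \<one> \<otimes> r c \<ominus> \<sigma> \<otimes> \<one> = \<ominus> (\<sigma> \<ominus> r c \<otimes> (a \<ominus> sc c))"
    proof -
      have "sc c \<in> carrier R" "r c \<in> carrier R" "\<sigma> \<in> carrier R" using * \<sigma> by auto
      with a show ?thesis by algebra
    qed
    also have "\<dots> \<in> M" using *(4)[of c] T[OF c] by simp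
    finally show "(a \<ominus> sc c) \<otimes> peval a 1 \<otimes> r c \<ominus> \<sigma> \<otimes> peval a 1 \<in> M" by (simp add: one)
  qed simp
qed

text \<open>Maximal ideals are the case \<open>S = {\<one>}\<close>. The residue field is therefore
  the field of complex numbers.\<close>

lemma maximalideal_scalar_residue:
  assumes "maximalideal M R" "a \<in> carrier R"
  obtains c where "a \<ominus> sc c \<in> M"
proof -
  interpret M: maximalideal M R by fact
  have "J = M" if "ideal J R" "M \<subseteq> J" "J \<inter> {\<one>} = {}" for J
    using M.I_maximal[OF that(1,2)] that ideal.Icarr[OF that(1)] by auto
  moreover have "\<one> \<notin> M" using M.I_notcarr M.one_imp_carrier by blast
  ultimately have "maximal_disjoint {\<one>} M"
    unfolding maximal_disjoint_def using M.is_ideal by blast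
  then show thesis
    using maximal_disjoint_scalar_residue[of "{\<one>}" M a] maximalideal_prime[OF assms(1)] assms(2) that
    by auto
qed

text \<open>Weak Nullstellensatz and Baire category theorem in one statement.\<close>

lemma exists_maximalideal_avoiding:
  assumes P: "primeideal P R" and W: "countable W" "W \<subseteq> carrier R" "W \<inter> P = {}"
  obtains M where "maximalideal M R" "P \<subseteq> M" "M \<inter> W = {}"
proof -
  interpret P: primeideal P R by fact
  \<comment> \<open>The multiplicative monoid generated by \<open>W\<close> is still countable, and
    it misses \<open>P\<close> because \<open>P\<close> is prime.\<close>
  define S where "S = (\<lambda>ws. foldr (\<otimes>) ws \<one>) ` lists W"
  have carr: "foldr (\<otimes>) ws \<one> \<in> carrier R" if "ws \<in> lists W" for ws
    using that W(2) by induction auto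
  have "countable S" using W by (simp add: S_def)
  moreover have "S \<subseteq> carrier R" using carr by (auto simp: S_def)
  moreover have "\<one> \<in> S" unfolding S_def by (rule image_eqI[of _ _ "[]"]) auto
  moreover have mult: "s \<otimes> t \<in> S" if st: "s \<in> S" "t \<in> S" for s t
  proof -
    obtain us vs where uv: "s = foldr (\<otimes>) us \<one>" "t = foldr (\<otimes>) vs \<one>" "us \<in> lists W" "vs \<in> lists W"
      using st unfolding S_def by blast
    from uv(3) have "foldr (\<otimes>) us \<one> \<otimes> foldr (\<otimes>) vs \<one> = foldr (\<otimes>) (us @ vs) \<one>"
      by induction (use carr uv(4) W(2) in \<open>auto simp: m_assoc subset_eq\<close>)
    then have "s \<otimes> t = foldr (\<otimes>) (us @ vs) \<one>" using uv by (simp only:)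
    moreover have "us @ vs \<in> lists W" using uv by simp
    ultimately show ?thesis unfolding S_def by (rule image_eqI)
  qed
  moreover have "foldr (\<otimes>) ws \<one> \<notin> P" if "ws \<in> lists W" for ws
    using that
  proof induction
    case (Cons w ws)
    then show ?case using P.I_prime[of w "foldr (\<otimes>) ws \<one>"] carr W by auto
  qed (simp add: P.one_notin)
  then have "P \<inter> S = {}" by (auto simp: S_def)
  moreover from exists_maximal_disjoint[OF P.is_ideal this]
  obtain M where M: "P \<subseteq> M" "maximal_disjoint S M" by blast
  ultimately have prime: "primeideal M R" using maximal_disjoint_prime by blast
  interpret M: primeideal M R by fact
  \<comment> \<open>Modulo \<open>M\<close> every element is a scalar, so an ideal strictly above
    \<open>M\<close> contains a nonzero scalar and is the whole ring.\<close>
  have "maximalideal M R"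
  proof (rule maximalidealI)
    fix J assume J: "ideal J R" "M \<subseteq> J" "J \<subseteq> carrier R"
    interpret J: ideal J R by fact
    show "J = M \<or> J = carrier R"
    proof (rule ccontr)
      assume "\<not> (J = M \<or> J = carrier R)"
      then obtain a where a: "a \<in> J" "a \<notin> M" and one: "\<one> \<notin> J"
        using J J.one_imp_carrier by blast
      obtain c where c: "a \<ominus> sc c \<in> M"
        using maximal_disjoint_scalar_residue[OF M(2) prime \<open>countable S\<close> \<open>S \<subseteq> carrier R\<close>]
          a J by blast
      have "a \<in> carrier R" using a J by blast
      then have "sc c \<in> J" using J.minus_mem_iff[of a "sc c"] a c J(2) by auto
      moreover have "c \<noteq> 0"
        using M.minus_mem_iff[of a "sc c"] a c \<open>a \<in> carrier R\<close> by auto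
      ultimately show False using sc_mult_mem_iff[OF J(1), of c \<one>] one by simp
    qed
  qed (use M.is_ideal M.I_notcarr in auto)
  moreover have "W \<subseteq> S"
  proof
    fix w assume "w \<in> W"
    then show "w \<in> S" unfolding S_def using W(2) by (intro image_eqI[of _ _ "[w]"]) auto
  qed
  then have "M \<inter> W = {}" using M(2) unfolding maximal_disjoint_def by blast
  ultimately show thesis using that M(1) by simp
qed

end

section \<open>Differential algebras\<close>

text \<open>The case of interest is \<open>D y x = {x, y}\<close> with \<open>K\<close> the carrier
  of a Poisson algebra; the stable ideals are then the Poisson ideals.\<close>

locale differential_algebra = complex_algebra +
  fixes K :: "'i set" and D :: "'i \<Rightarrow> 'a \<Rightarrow> 'a"
  assumes D_closed [simp, intro]: "i \<in> K \<Longrightarrow> x \<in> carrier R \<Longrightarrow> D i x \<in> carrier R"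
    and D_add: "i \<in> K \<Longrightarrow> x \<in> carrier R \<Longrightarrow> y \<in> carrier R \<Longrightarrow> D i (x \<oplus> y) = D i x \<oplus> D i y"
    and D_mult: "i \<in> K \<Longrightarrow> x \<in> carrier R \<Longrightarrow> y \<in> carrier R \<Longrightarrow>
      D i (x \<otimes> y) = x \<otimes> D i y \<oplus> y \<otimes> D i x"
    and D_sc [simp]: "i \<in> K \<Longrightarrow> D i (sc c) = \<zero>"
begin

lemma D_scale:
  "i \<in> K \<Longrightarrow> x \<in> carrier R \<Longrightarrow> D i (sc c \<otimes> x) = sc c \<otimes> D i x"
  by (simp add: D_mult)

lemma D_minus:
  assumes "i \<in> K" "x \<in> carrier R" "y \<in> carrier R"
  shows "D i (x \<ominus> y) = D i x \<ominus> D i y"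
proof -
  have *: "x \<ominus> y = x \<oplus> sc (-1) \<otimes> y" if "x \<in> carrier R" "y \<in> carrier R" for x y
    using that by (simp add: sc_minus a_minus_def l_minus)
  show ?thesis using assms by (simp add: * D_add D_scale)
qed

definition stable :: "'a set \<Rightarrow> bool" where
  "stable I \<longleftrightarrow> ideal I R \<and> (\<forall>i\<in>K. \<forall>x\<in>I. D i x \<in> I)"

lemma funpow_D_closed [simp]: "i \<in> K \<Longrightarrow> x \<in> carrier R \<Longrightarrow> (D i ^^ k) x \<in> carrier R"
  by (induction k) auto

lemma funpow_D_add:
  "i \<in> K \<Longrightarrow> x \<in> carrier R \<Longrightarrow> y \<in> carrier R \<Longrightarrow>
    (D i ^^ k) (x \<oplus> y) = (D i ^^ k) x \<oplus> (D i ^^ k) y"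
  by (induction k) (auto simp: D_add)

lemma funpow_D_stable: "stable I \<Longrightarrow> i \<in> K \<Longrightarrow> x \<in> I \<Longrightarrow> (D i ^^ k) x \<in> I"
  by (induction k) (auto simp: stable_def)

subsection \<open>The largest stable ideal inside a prime ideal is prime\<close>

text \<open>For an ideal \<open>Q\<close> this is the largest ideal inside \<open>Q\<close> that is
  stable under the single derivation \<open>D i\<close>.\<close>

definition D_core :: "'i \<Rightarrow> 'a set \<Rightarrow> 'a set" where
  "D_core i Q = {x \<in> carrier R. \<forall>k. (D i ^^ k) x \<in> Q}"

text \<open>If \<open>n\<close> and \<open>m\<close> are the least orders at which the derivatives of \<open>a\<close> and \<open>b\<close> leave \<open>Q\<close>, then
  all terms but one of the Leibniz expansion of the derivative of \<open>a b\<close> of order \<open>n + m\<close> are in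
  \<open>Q\<close>.\<close>

lemma funpow_D_leading_term:
  assumes "ideal Q R" and i: "i \<in> K" and ab: "a \<in> carrier R" "b \<in> carrier R"
    and low: "\<And>j. j < n \<Longrightarrow> (D i ^^ j) a \<in> Q" "\<And>j. j < m \<Longrightarrow> (D i ^^ j) b \<in> Q"
    and "j + l + k = n + m"
  shows "\<exists>c::nat. (j \<le> n \<and> l \<le> m \<longrightarrow> c > 0) \<and>
    (D i ^^ k) ((D i ^^ j) a \<otimes> (D i ^^ l) b) \<ominus>
      sc (of_nat c) \<otimes> ((D i ^^ n) a \<otimes> (D i ^^ m) b) \<in> Q"
  using \<open>j + l + k = n + m\<close>
proof (induction k arbitrary: j l)
  interpret Q: ideal Q R by fact
  let ?z = "(D i ^^ n) a \<otimes> (D i ^^ m) b"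
  have z: "?z \<in> carrier R" using i ab by simp
  {
    case 0
    show ?case
    proof (cases "j = n \<and> l = m")
      case True
      then show ?thesis using z by (intro exI[of _ 1]) (auto simp: r_neg a_minus_def)
    next
      case False
      \<comment> \<open>Since \<open>j + l = n + m\<close>, one index is too small and the other too
        large: the product is in \<open>Q\<close> and the coefficient is \<open>0\<close>.\<close>
      with 0 have "j < n \<or> l < m" "\<not> (j \<le> n \<and> l \<le> m)" by auto
      moreover from this have "(D i ^^ j) a \<otimes> (D i ^^ l) b \<in> Q"
        using low i ab by (auto intro: Q.I_l_closed Q.I_r_closed)
      ultimately show ?thesis using z i ab by (intro exI[of _ 0]) (auto simp: a_minus_def)
    qed
  next
    case (Suc k)
    \<comment> \<open>The next derivative falls on either factor, and the two coefficients add up as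
      in Pascal's triangle.\<close>
    let ?u = "(D i ^^ j) a" and ?v = "(D i ^^ l) b"
    let ?x = "(D i ^^ k) (?u \<otimes> (D i ^^ Suc l) b)" and ?y = "(D i ^^ k) ((D i ^^ Suc j) a \<otimes> ?v)"
    obtain c where c: "j \<le> n \<and> Suc l \<le> m \<longrightarrow> c > 0" "?x \<ominus> sc (of_nat c) \<otimes> ?z \<in> Q"
      using Suc.IH[of j "Suc l"] Suc.prems by auto
    obtain d where d: "Suc j \<le> n \<and> l \<le> m \<longrightarrow> d > 0" "?y \<ominus> sc (of_nat d) \<otimes> ?z \<in> Q"
      using Suc.IH[of "Suc j" l] Suc.prems by auto
    have uv: "?u \<in> carrier R" "?v \<in> carrier R" using i ab by auto
    have xy: "?x \<in> carrier R" "?y \<in> carrier R" using i ab by auto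
    have "(D i ^^ Suc k) (?u \<otimes> ?v) = (D i ^^ k) (D i (?u \<otimes> ?v))"
      by (simp add: funpow_swap1)
    also have "D i (?u \<otimes> ?v) = ?u \<otimes> (D i ^^ Suc l) b \<oplus> (D i ^^ Suc j) a \<otimes> ?v"
      using i uv by (simp add: D_mult m_comm)
    also have "(D i ^^ k) \<dots> = ?x \<oplus> ?y"
      using i ab by (intro funpow_D_add) auto
    finally have "(D i ^^ Suc k) (?u \<otimes> ?v) \<ominus> sc (of_nat (c + d)) \<otimes> ?z =
        ?x \<oplus> ?y \<ominus> (sc (of_nat c) \<oplus> sc (of_nat d)) \<otimes> ?z"
      by (simp add: sc_add)
    also have "\<dots> = (?x \<ominus> sc (of_nat c) \<otimes> ?z) \<oplus> (?y \<ominus> sc (of_nat d) \<otimes> ?z)"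
    proof -
      have "sc (of_nat c) \<in> carrier R" "sc (of_nat d) \<in> carrier R" by auto
      with xy z show ?thesis by algebra
    qed
    also have "\<dots> \<in> Q" using c d by simp
    finally have "(D i ^^ Suc k) (?u \<otimes> ?v) \<ominus> sc (of_nat (c + d)) \<otimes> ?z \<in> Q" .
    \<comment> \<open>As \<open>j + l < n + m\<close>, one of \<open>j\<close> and \<open>l\<close>
      can still be raised within its bound, so one of \<open>c\<close> and \<open>d\<close> is
      positive.\<close>
    moreover have "j \<le> n \<and> l \<le> m \<longrightarrow> c + d > 0"
      using c(1) d(1) Suc.prems by (cases "j < n") auto
    ultimately show ?case by blast
  }
qed

text \<open>If \<open>a\<close> and \<open>b\<close> are outside the core, let \<open>n\<close> and
  \<open>m\<close> be the first orders at which their derivatives leave \<open>Q\<close>. The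
  derivative of \<open>a b\<close> of order \<open>n + m\<close> is, modulo \<open>Q\<close>, a
  positive integer multiple of a product outside \<open>Q\<close>, and positive integers are units
  in characteristic zero.\<close>

lemma D_core_prime:
  assumes "primeideal Q R" and i: "i \<in> K"
  shows "primeideal (D_core i Q) R"
proof (rule primeidealI)
  interpret Q: primeideal Q R by fact
  \<comment> \<open>The induction is on \<open>k\<close> for all \<open>r\<close> and
    \<open>x\<close> at once, because Leibniz's rule writes the derivative of \<open>r x\<close> as
    a sum of two products of the same kind.\<close>
  have mult: "(D i ^^ k) (r \<otimes> x) \<in> Q" if "r \<in> carrier R" "x \<in> D_core i Q" for r x k
    using that
  proof (induction k arbitrary: r x)
    case 0
    then have "(D i ^^ 0) x \<in> Q" unfolding D_core_def by blast
    then show ?case using 0 by (simp add: Q.I_l_closed)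
  next
    case (Suc k)
    have x: "x \<in> carrier R" using Suc.prems by (simp add: D_core_def)
    have "(D i ^^ Suc l) x \<in> Q" for l using Suc.prems unfolding D_core_def by blast
    then have Dx: "D i x \<in> D_core i Q"
      using x i by (simp add: D_core_def funpow_swap1)
    have "(D i ^^ Suc k) (r \<otimes> x) = (D i ^^ k) (D i (r \<otimes> x))" by (simp add: funpow_swap1)
    also have "\<dots> = (D i ^^ k) (r \<otimes> D i x) \<oplus> (D i ^^ k) (D i r \<otimes> x)"
      using Suc.prems(1) x i by (simp add: D_mult funpow_D_add m_comm)
    also have "\<dots> \<in> Q" using Suc.IH Suc.prems Dx i by simp
    finally show ?case .
  qed
  show "ideal (D_core i Q) R"
    unfolding ideal_iff_closed
  proof (intro conjI ballI)
    have "(D i ^^ k) \<zero> = \<zero>" for k by (induction k) (use i D_sc[of i 0] in auto)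
    then show "\<zero> \<in> D_core i Q" by (simp add: D_core_def)
  qed (use i mult in \<open>auto simp: D_core_def funpow_D_add\<close>)
  show "carrier R \<noteq> D_core i Q"
    using Q.one_notin by (auto simp: D_core_def set_eq_iff intro!: exI[of _ \<one>] exI[of _ 0])
  fix a b assume ab: "a \<in> carrier R" "b \<in> carrier R" "a \<otimes> b \<in> D_core i Q"
  show "a \<in> D_core i Q \<or> b \<in> D_core i Q"
  proof (rule ccontr)
    assume "\<not> ?thesis"
    then have ex: "\<exists>n. (D i ^^ n) a \<notin> Q" "\<exists>m. (D i ^^ m) b \<notin> Q"
      using ab by (auto simp: D_core_def)
    define n m where "n = (LEAST n. (D i ^^ n) a \<notin> Q)" and "m = (LEAST m. (D i ^^ m) b \<notin> Q)"
    have nm: "(D i ^^ n) a \<notin> Q" "(D i ^^ m) b \<notin> Q"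
      using LeastI_ex[OF ex(1)] LeastI_ex[OF ex(2)] by (simp_all add: n_def m_def)
    let ?z = "(D i ^^ n) a \<otimes> (D i ^^ m) b"
    have low: "\<And>j. j < n \<Longrightarrow> (D i ^^ j) a \<in> Q" "\<And>j. j < m \<Longrightarrow> (D i ^^ j) b \<in> Q"
      unfolding n_def m_def using not_less_Least by blast+
    have "0 + 0 + (n + m) = n + m" by simp
    from funpow_D_leading_term[OF Q.is_ideal i ab(1,2) low this]
    obtain c :: nat where c: "c > 0" "(D i ^^ (n + m)) (a \<otimes> b) \<ominus> sc (of_nat c) \<otimes> ?z \<in> Q"
      by auto
    have "(D i ^^ (n + m)) (a \<otimes> b) \<in> Q" using ab(3) unfolding D_core_def by blast
    then have "sc (of_nat c) \<otimes> ?z \<in> Q"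
      using Q.minus_mem_iff[OF _ _ c(2)] i ab by simp
    then have "?z \<in> Q" using sc_mult_mem_iff[OF Q.is_ideal] c(1) i ab by simp
    then show False using Q.I_prime nm i ab by (meson funpow_D_closed)
  qed
qed (rule is_cring)

text \<open>Zorn's lemma: the intersection of a nonempty chain of primes is prime. Passing to
  complements turns minimal primes into maximal elements.\<close>

lemma exists_minimal_prime_between:
  assumes M: "primeideal M R" and C: "C \<subseteq> M"
  obtains Q where "primeideal Q R" "C \<subseteq> Q" "Q \<subseteq> M"
    "\<And>Q'. primeideal Q' R \<Longrightarrow> C \<subseteq> Q' \<Longrightarrow> Q' \<subseteq> Q \<Longrightarrow> Q' = Q"
proof -
  interpret M: primeideal M R by fact
  define F where "F = {S. S \<subseteq> carrier R \<and> primeideal (carrier R - S) R \<and>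
    C \<subseteq> carrier R - S \<and> carrier R - S \<subseteq> M}"
  have "\<exists>S\<in>F. \<forall>T\<in>F. S \<subseteq> T \<longrightarrow> T = S"
  proof (rule subset_Zorn_nonempty)
    have "carrier R - (carrier R - M) = M" using M.a_subset by blast
    then show "F \<noteq> {}" using M C unfolding F_def by (auto intro!: exI[of _ "carrier R - M"])
    fix \<C> assume \<C>: "\<C> \<noteq> {}" "subset.chain F \<C>"
    have mem: "S \<in> F" if "S \<in> \<C>" for S using \<C>(2) that unfolding pred_on.chain_def by blast
    have id: "ideal (carrier R - S) R" if "S \<in> \<C>" for S
      using mem[OF that] unfolding F_def by (blast dest: primeideal.axioms(1))
    have chain: "S \<subseteq> T \<or> T \<subseteq> S" if "S \<in> \<C>" "T \<in> \<C>" for S T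
      using \<C>(2) that unfolding pred_on.chain_def by blast
    have "primeideal (carrier R - \<Union>\<C>) R"
    proof (rule primeidealI)
      show "ideal (carrier R - \<Union>\<C>) R"
        using id unfolding ideal_iff_closed by blast
      obtain S where "S \<in> \<C>" using \<C>(1) by blast
      then have "primeideal (carrier R - S) R" using mem unfolding F_def by blast
      then show "carrier R \<noteq> carrier R - \<Union>\<C>"
        using primeideal.one_notin[of "carrier R - S" R] \<open>S \<in> \<C>\<close> by blast
      fix a b assume ab: "a \<in> carrier R" "b \<in> carrier R" "a \<otimes> b \<in> carrier R - \<Union>\<C>"
      show "a \<in> carrier R - \<Union>\<C> \<or> b \<in> carrier R - \<Union>\<C>"
      proof (rule ccontr)
        assume "\<not> ?thesis"
        then obtain S T where "S \<in> \<C>" "a \<in> S" "T \<in> \<C>" "b \<in> T" using ab by blast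
        then obtain U where U: "U \<in> \<C>" "a \<in> U" "b \<in> U" using chain by blast
        then have "primeideal (carrier R - U) R" using mem unfolding F_def by blast
        from primeideal.I_prime[OF this ab(1,2)] show False using ab U by blast
      qed
    qed (rule is_cring)
    moreover have "\<Union>\<C> \<subseteq> carrier R" "C \<subseteq> carrier R - \<Union>\<C>"
      using mem M.a_subset C unfolding F_def by blast+
    moreover have "carrier R - \<Union>\<C> \<subseteq> M"
      using mem \<C>(1) unfolding F_def by blast
    ultimately show "\<Union>\<C> \<in> F" by (simp add: F_def)
  qed
  then obtain S where S: "S \<in> F" "\<And>T. T \<in> F \<Longrightarrow> S \<subseteq> T \<Longrightarrow> T = S" by blast
  show thesis
  proof (rule that[of "carrier R - S"])
    fix Q' assume Q': "primeideal Q' R" "C \<subseteq> Q'" "Q' \<subseteq> carrier R - S"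
    have "carrier R - (carrier R - Q') = Q'" using Q'(3) by blast
    then have "carrier R - Q' \<in> F" using Q' S(1) unfolding F_def by auto
    moreover have "S \<subseteq> carrier R - Q'" using Q'(3) S(1) unfolding F_def by blast
    ultimately have "carrier R - Q' = S" by (rule S(2))
    then show "Q' = carrier R - S" using Q'(3) by blast
  qed (use S(1) in \<open>auto simp: F_def\<close>)
qed

text \<open>A minimal prime over a stable ideal is stable, because it equals all of its cores.\<close>

lemma prime_of_greatest_stable:
  assumes M: "primeideal M R" and C: "stable C" "C \<subseteq> M"
    and greatest: "\<And>I. stable I \<Longrightarrow> I \<subseteq> M \<Longrightarrow> I \<subseteq> C"
  shows "primeideal C R"
proof -
  obtain Q where Q: "primeideal Q R" "C \<subseteq> Q" "Q \<subseteq> M"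
    and min: "\<And>Q'. primeideal Q' R \<Longrightarrow> C \<subseteq> Q' \<Longrightarrow> Q' \<subseteq> Q \<Longrightarrow> Q' = Q"
    using exists_minimal_prime_between[OF M C(2)] by metis
  have id: "ideal Q R" "ideal C R" using Q(1) C(1) by (auto simp: primeideal_def stable_def)
  have "D i x \<in> Q" if "i \<in> K" "x \<in> Q" for i x
  proof -
    have "C \<subseteq> D_core i Q"
      using funpow_D_stable[OF C(1) that(1)] Q(2) ideal.Icarr[OF id(2)] by (auto simp: D_core_def)
    moreover have "D_core i Q \<subseteq> Q" by (auto simp: D_core_def dest: spec[of _ 0])
    ultimately have "D_core i Q = Q" using min D_core_prime[OF Q(1) that(1)] by blast
    then have "(D i ^^ 1) x \<in> Q" using that(2) unfolding D_core_def by blast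
    then show ?thesis by simp
  qed
  then have "stable Q" using id by (simp add: stable_def)
  then have "Q = C" using greatest Q by blast
  then show ?thesis using Q by simp
qed

end

context differential_algebra
begin

subsection \<open>Rational prime ideals\<close>

text \<open>Modulo a stable prime ideal \<open>P\<close>, the fraction \<open>a / b\<close> is annihilated by all derivations.\<close>

definition constant_fraction :: "'a set \<Rightarrow> 'a \<Rightarrow> 'a \<Rightarrow> bool" where
  "constant_fraction P a b \<longleftrightarrow> (\<forall>i\<in>K. b \<otimes> D i a \<ominus> a \<otimes> D i b \<in> P)"

definition rational :: "'a set \<Rightarrow> bool" where
  "rational P \<longleftrightarrow> (\<forall>a\<in>carrier R. \<forall>b\<in>carrier R - P.
    constant_fraction P a b \<longrightarrow> (\<exists>c. a \<ominus> sc c \<otimes> b \<in> P))"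

text \<open>The set consists of the denominators of \<open>a / b\<close>, that is, of all
  \<open>d\<close> with \<open>d (a / b)\<close> in \<open>R / P\<close>. Differentiating
  \<open>d (a / b) = h\<close> with \<open>a / b\<close> constant gives
  \<open>D i d (a / b) = D i h\<close>, so \<open>D i d\<close> is a denominator too.\<close>

lemma stable_denominators:
  assumes P: "primeideal P R" "stable P" and ab: "a \<in> carrier R" "b \<in> carrier R - P"
    and const: "constant_fraction P a b"
  shows "stable {d \<in> carrier R. \<exists>h\<in>carrier R. d \<otimes> a \<ominus> b \<otimes> h \<in> P}" (is "stable ?I")
  unfolding stable_def
proof (intro conjI ballI)
  interpret P: primeideal P R by fact
  have b: "b \<in> carrier R" using ab by simp
  note [simp] = ab(1) b
  show "ideal ?I R"
    unfolding ideal_iff_closed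
  proof (intro conjI ballI)
    show "\<zero> \<in> ?I" by (auto intro!: bexI[of _ \<zero>] simp: a_minus_def)
  next
    fix x y assume "x \<in> ?I" "y \<in> ?I"
    then obtain h k where *: "x \<in> carrier R" "y \<in> carrier R" "h \<in> carrier R" "k \<in> carrier R"
      "x \<otimes> a \<ominus> b \<otimes> h \<in> P" "y \<otimes> a \<ominus> b \<otimes> k \<in> P" by blast
    have "(x \<oplus> y) \<otimes> a \<ominus> b \<otimes> (h \<oplus> k) = (x \<otimes> a \<ominus> b \<otimes> h) \<oplus> (y \<otimes> a \<ominus> b \<otimes> k)"
      using *(1-4) ab(1) b by algebra
    then have "(x \<oplus> y) \<otimes> a \<ominus> b \<otimes> (h \<oplus> k) \<in> P" using *(5,6) by simp
    then show "x \<oplus> y \<in> ?I" using * by auto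
  next
    fix r x assume r: "r \<in> carrier R" and "x \<in> ?I"
    then obtain h where *: "x \<in> carrier R" "h \<in> carrier R" "x \<otimes> a \<ominus> b \<otimes> h \<in> P" by blast
    have "(r \<otimes> x) \<otimes> a \<ominus> b \<otimes> (r \<otimes> h) = r \<otimes> (x \<otimes> a \<ominus> b \<otimes> h)"
      using *(1,2) r ab(1) b by algebra
    then have "(r \<otimes> x) \<otimes> a \<ominus> b \<otimes> (r \<otimes> h) \<in> P" using P.I_l_closed[OF *(3) r] by simp
    then show "r \<otimes> x \<in> ?I" using * r by auto
  qed auto
  fix i d assume i: "i \<in> K" and "d \<in> ?I"
  then obtain h where d: "d \<in> carrier R" "h \<in> carrier R" "d \<otimes> a \<ominus> b \<otimes> h \<in> P" by blast
  note car = d(1,2) ab(1) b D_closed[OF i d(1)] D_closed[OF i d(2)] D_closed[OF i ab(1)]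
    D_closed[OF i b]
  have De: "D i (d \<otimes> a \<ominus> b \<otimes> h) \<in> P" using P(2) i d unfolding stable_def by blast
  have cent: "b \<otimes> D i a \<ominus> a \<otimes> D i b \<in> P" using const i unfolding constant_fraction_def by blast
  have "D i (d \<otimes> a \<ominus> b \<otimes> h) = (d \<otimes> D i a \<oplus> a \<otimes> D i d) \<ominus> (b \<otimes> D i h \<oplus> h \<otimes> D i b)"
    using i car by (simp add: D_minus D_mult)
  then have "b \<otimes> (D i d \<otimes> a \<ominus> b \<otimes> D i h) =
      (b \<otimes> D i (d \<otimes> a \<ominus> b \<otimes> h) \<ominus> d \<otimes> (b \<otimes> D i a \<ominus> a \<otimes> D i b)) \<ominus> D i b \<otimes> (d \<otimes> a \<ominus> b \<otimes> h)"
    apply (simp only:)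
    using car by algebra
  also have "\<dots> \<in> P"
    by (rule P.minus_closed[OF P.minus_closed[OF P.I_l_closed P.I_l_closed] P.I_l_closed])
      (fact De b cent d car)+
  finally have "D i d \<otimes> a \<ominus> b \<otimes> D i h \<in> P"
    using P.I_prime[OF b, of "D i d \<otimes> a \<ominus> b \<otimes> D i h"] ab(2) car by auto
  then show "D i d \<in> ?I" using car by blast
qed

text \<open>Since \<open>P\<close> is the only stable ideal between \<open>P\<close> and \<open>M\<close>, a constant \<open>a / b\<close> has a denominator
  \<open>d\<close> outside \<open>M\<close>. If \<open>c\<close> is its value modulo \<open>M\<close>, then the numerators of \<open>a / b - c\<close> form a stable
  ideal inside \<open>M\<close>, so \<open>a / b = c\<close>.\<close>

lemma rational_of_greatest_stable:
  assumes M: "primeideal M R" "\<And>x. x \<in> carrier R \<Longrightarrow> \<exists>c. x \<ominus> sc c \<in> M"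
    and P: "primeideal P R" "stable P" "P \<subseteq> M"
    and greatest: "\<And>I. stable I \<Longrightarrow> I \<subseteq> M \<Longrightarrow> I \<subseteq> P"
  shows "rational P"
  unfolding rational_def
proof (intro ballI impI)
  interpret P: primeideal P R by fact
  interpret M: primeideal M R by fact
  fix a b assume ab: "a \<in> carrier R" "b \<in> carrier R - P" and const: "constant_fraction P a b"
  let ?I = "{d \<in> carrier R. \<exists>h\<in>carrier R. d \<otimes> a \<ominus> b \<otimes> h \<in> P}"
  have b: "b \<in> carrier R" using ab by simp
  have "b \<otimes> a \<ominus> b \<otimes> a \<in> P" using ab(1) b by (simp add: a_minus_def r_neg)
  then have "b \<in> ?I" using ab(1) b by blast
  then have "\<not> ?I \<subseteq> M" using greatest[OF stable_denominators[OF P(1,2) ab const]] ab(2) by blast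
  then obtain d h where d: "d \<in> carrier R" "d \<notin> M" "h \<in> carrier R" "d \<otimes> a \<ominus> b \<otimes> h \<in> P" by blast
  obtain \<delta> \<eta> where \<delta>: "d \<ominus> sc \<delta> \<in> M" and \<eta>: "h \<ominus> sc \<eta> \<in> M" using M(2) d by metis
  have "\<delta> \<noteq> 0" using \<delta> d M.minus_mem_iff[of d "sc \<delta>"] by auto
  \<comment> \<open>This is the value of \<open>a / b = h / d\<close> modulo \<open>M\<close>, and
    \<open>g\<close> is the numerator of \<open>a / b - c\<close> over the denominator
    \<open>d\<close>.\<close>
  define c where "c = \<eta> / \<delta>"
  define g where "g = h \<ominus> sc c \<otimes> d"
  have g: "g \<in> carrier R" using d by (simp add: g_def)
  have "\<eta> = c * \<delta>" using \<open>\<delta> \<noteq> 0\<close> by (simp add: c_def)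
  then have \<eta>': "sc \<eta> = sc c \<otimes> sc \<delta>" by (simp add: sc_mult)
  have "g = (h \<ominus> sc \<eta>) \<ominus> sc c \<otimes> (d \<ominus> sc \<delta>)"
  proof -
    have "sc c \<in> carrier R" "sc \<delta> \<in> carrier R" by auto
    then show ?thesis unfolding \<eta>' g_def using d(1,3) by algebra
  qed
  then have "g \<in> M" using M.minus_closed[OF \<eta> M.I_l_closed[OF \<delta>, of "sc c"]] by simp
  have "g \<in> P"
  proof (rule ccontr)
    assume "g \<notin> P"
    \<comment> \<open>The inverse \<open>d / g\<close> of the nonzero constant \<open>g / d\<close>
      is constant as well. The denominators of \<open>d / g\<close> are the numerators of
      \<open>g / d\<close>; they lie in \<open>M\<close> because \<open>g\<close> does and
      \<open>d\<close> does not.\<close>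
    have "constant_fraction P d g"
      unfolding constant_fraction_def
    proof
      fix i assume i: "i \<in> K"
      note car = d(1,3) ab(1) b D_closed[OF i d(1)] D_closed[OF i d(3)] D_closed[OF i ab(1)]
        D_closed[OF i b] sc_closed[of c]
      have "D i g = D i h \<ominus> sc c \<otimes> D i d" using i d by (simp add: g_def D_minus D_scale)
      then have eq: "g \<otimes> D i d \<ominus> d \<otimes> D i g = h \<otimes> D i d \<ominus> d \<otimes> D i h"
        apply (simp only: g_def)
        using car by algebra
      let ?e = "d \<otimes> a \<ominus> b \<otimes> h" and ?f = "b \<otimes> D i a \<ominus> a \<otimes> D i b"
      have De: "D i ?e \<in> P" using P(2) i d unfolding stable_def by blast
      have f: "?f \<in> P" using const i unfolding constant_fraction_def by blast
      have "D i ?e = (d \<otimes> D i a \<oplus> a \<otimes> D i d) \<ominus> (b \<otimes> D i h \<oplus> h \<otimes> D i b)"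
        using i car by (simp add: D_minus D_mult)
      then have "(b \<otimes> b) \<otimes> (h \<otimes> D i d \<ominus> d \<otimes> D i h) =
          ((b \<otimes> d) \<otimes> D i ?e \<ominus> (d \<otimes> d) \<otimes> ?f) \<ominus> (b \<otimes> D i d \<oplus> d \<otimes> D i b) \<otimes> ?e"
        apply (simp only:)
        using car by algebra
      also have "\<dots> \<in> P"
        by (rule P.minus_closed[OF P.minus_closed[OF P.I_l_closed P.I_l_closed] P.I_l_closed])
          (use De f d(4) car in simp_all)
      finally have "(b \<otimes> b) \<otimes> (h \<otimes> D i d \<ominus> d \<otimes> D i h) \<in> P" .
      moreover have "b \<otimes> b \<notin> P" using P.I_prime[OF b b] ab(2) by blast
      ultimately show "g \<otimes> D i d \<ominus> d \<otimes> D i g \<in> P"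
        unfolding eq using P.I_prime[of "b \<otimes> b" "h \<otimes> D i d \<ominus> d \<otimes> D i h"] car by auto
    qed
    then have stable: "stable {y \<in> carrier R. \<exists>z\<in>carrier R. y \<otimes> d \<ominus> g \<otimes> z \<in> P}" (is "stable ?J")
      using stable_denominators[OF P(1,2) d(1)] g \<open>g \<notin> P\<close> by blast
    have "?J \<subseteq> M"
    proof
      fix y assume "y \<in> ?J"
      then obtain z where *: "y \<in> carrier R" "z \<in> carrier R" "y \<otimes> d \<ominus> g \<otimes> z \<in> P" by blast
      have "g \<otimes> z \<in> M" using M.I_r_closed[OF \<open>g \<in> M\<close>] * by blast
      then have "y \<otimes> d \<in> M"
        using M.minus_mem_iff[of "y \<otimes> d" "g \<otimes> z"] * P(3) g d by blast
      then show "y \<in> M" using M.I_prime * d by blast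
    qed
    then have "?J \<subseteq> P" by (rule greatest[OF stable])
    moreover have "g \<otimes> d \<ominus> g \<otimes> d \<in> P" using g d by (simp add: a_minus_def r_neg)
    then have "g \<in> ?J" using g d by blast
    ultimately show False using \<open>g \<notin> P\<close> by blast
  qed
  have "d \<otimes> (a \<ominus> sc c \<otimes> b) = (d \<otimes> a \<ominus> b \<otimes> h) \<oplus> b \<otimes> g"
    unfolding g_def using d(1,3) ab(1) b sc_closed[of c] by algebra
  also have "\<dots> \<in> P" using d(4) P.I_l_closed[OF \<open>g \<in> P\<close> b] by simp
  finally have "a \<ominus> sc c \<otimes> b \<in> P"
    using P.I_prime[of d "a \<ominus> sc c \<otimes> b"] d P(3) ab(1) b by auto
  then show "\<exists>c. a \<ominus> sc c \<otimes> b \<in> P" by blast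
qed

subsection \<open>A Jacobson density argument\<close>

text \<open>The ring of operators on \<open>R\<close> generated by the multiplications and the
  derivations. Its submodules of \<open>R\<close> are the stable ideals, which is what makes a
  density argument possible.\<close>

inductive_set diff_ops :: "('a \<Rightarrow> 'a) set" where
  id: "(\<lambda>x. x) \<in> diff_ops"
| deriv: "\<Delta> \<in> diff_ops \<Longrightarrow> i \<in> K \<Longrightarrow> (\<lambda>x. D i (\<Delta> x)) \<in> diff_ops"
| mult: "\<Delta> \<in> diff_ops \<Longrightarrow> r \<in> carrier R \<Longrightarrow> (\<lambda>x. r \<otimes> \<Delta> x) \<in> diff_ops"
| add: "\<Delta> \<in> diff_ops \<Longrightarrow> \<Gamma> \<in> diff_ops \<Longrightarrow> (\<lambda>x. \<Delta> x \<oplus> \<Gamma> x) \<in> diff_ops"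

lemma diff_ops_closed: "\<Delta> \<in> diff_ops \<Longrightarrow> x \<in> carrier R \<Longrightarrow> \<Delta> x \<in> carrier R"
  by (induction rule: diff_ops.induct) auto

lemma diff_ops_add:
  "\<Delta> \<in> diff_ops \<Longrightarrow> x \<in> carrier R \<Longrightarrow> y \<in> carrier R \<Longrightarrow> \<Delta> (x \<oplus> y) = \<Delta> x \<oplus> \<Delta> y"
  by (induction rule: diff_ops.induct) (auto simp: D_add r_distr diff_ops_closed a_ac)

lemma diff_ops_scale:
  "\<Delta> \<in> diff_ops \<Longrightarrow> x \<in> carrier R \<Longrightarrow> \<Delta> (sc c \<otimes> x) = sc c \<otimes> \<Delta> x"
  by (induction rule: diff_ops.induct) (auto simp: D_scale r_distr diff_ops_closed m_lcomm)

lemma diff_ops_stable: "\<Delta> \<in> diff_ops \<Longrightarrow> stable I \<Longrightarrow> x \<in> I \<Longrightarrow> \<Delta> x \<in> I"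
  by (induction rule: diff_ops.induct)
    (auto simp: stable_def ideal_iff_closed)

text \<open>If the induction step fails, then \<open>\<Delta>0 x / \<Delta>0 (e n)\<close> is the same fraction for all operators
  \<open>\<Delta>0\<close> that vanish on the span, because these are closed under the derivations; hence it is a
  constant, and so a scalar by rationality.\<close>

lemma diff_ops_separate:
  assumes P: "primeideal P R" "stable P" "rational P" and e: "range e \<subseteq> carrier R"
    and "x \<in> carrier R" "x \<notin> lspan P e n"
  shows "\<exists>\<Delta>\<in>diff_ops. (\<forall>v\<in>lspan P e n. \<Delta> v \<in> P) \<and> \<Delta> x \<notin> P"
  using assms(5,6)
proof (induction n arbitrary: x)
  case 0
  then show ?case using diff_ops.id by (intro bexI[of _ "\<lambda>x. x"]) auto
next
  case (Suc n)
  interpret P: primeideal P R by (fact P(1))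
  let ?V = "lspan P e n" and ?f = "e n"
  note Pid = P.is_ideal
  have f: "?f \<in> carrier R" using e by blast
  have V: "?V \<subseteq> carrier R" by (rule lspan_subset[OF Pid e])
  have xV: "x \<notin> ?V" using lspan_step[OF Pid e] Suc.prems by blast
  show ?case
  proof (cases "?f \<in> ?V")
    case True
    then have "lspan P e (Suc n) \<subseteq> ?V"
      using lspan_add[OF Pid e] lspan_scale[OF Pid e] by auto
    then show ?thesis using Suc.IH[OF Suc.prems(1) xV] by blast
  next
    case False
    then obtain \<Delta>0 where \<Delta>0: "\<Delta>0 \<in> diff_ops" "\<forall>v\<in>?V. \<Delta>0 v \<in> P" "\<Delta>0 ?f \<notin> P"
      using Suc.IH f by blast
    define L where "L = {\<Delta> \<in> diff_ops. \<forall>v\<in>?V. \<Delta> v \<in> P}"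
    define w u where "w = \<Delta>0 ?f" and "u = \<Delta>0 x"
    have L: "\<Delta> \<in> diff_ops" "\<And>v. v \<in> ?V \<Longrightarrow> \<Delta> v \<in> P" "\<Delta> x \<in> carrier R" "\<Delta> ?f \<in> carrier R"
      if "\<Delta> \<in> L" for \<Delta>
      using that f Suc.prems(1) diff_ops_closed by (auto simp: L_def)
    have "\<Delta>0 \<in> L" using \<Delta>0 by (simp add: L_def)
    have w: "w \<in> carrier R" "w \<notin> P" and u: "u \<in> carrier R"
      using L(3,4)[OF \<open>\<Delta>0 \<in> L\<close>] \<Delta>0(3) by (simp_all add: w_def u_def)
    show ?thesis
    proof (rule ccontr)
      assume none: "\<not> ?thesis"
      \<comment> \<open>Such an operator kills all of \<open>lspan P e (Suc n)\<close> modulo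
        \<open>P\<close>, and by assumption no operator separates \<open>x\<close> from this
        span.\<close>
      have kill: "\<Delta> x \<in> P" if \<Delta>: "\<Delta> \<in> L" and "\<Delta> ?f \<in> P" for \<Delta>
      proof -
        have "\<Delta> v \<in> P" if "v \<in> lspan P e (Suc n)" for v
        proof -
          obtain y c where y: "v = y \<oplus> sc c \<otimes> ?f" "y \<in> ?V" using \<open>v \<in> lspan P e (Suc n)\<close> by auto
          then have "\<Delta> v = \<Delta> y \<oplus> sc c \<otimes> \<Delta> ?f"
            using V f L(1)[OF \<Delta>] by (auto simp: diff_ops_add diff_ops_scale subset_eq)
          then show ?thesis
            using L(2)[OF \<Delta> y(2)] P.I_l_closed[OF \<open>\<Delta> ?f \<in> P\<close> sc_closed] by simp
        qed
        then show ?thesis using none L(1)[OF \<Delta>] by blast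
      qed
      have rel: "\<Delta> ?f \<otimes> u \<ominus> w \<otimes> \<Delta> x \<in> P" if \<Delta>: "\<Delta> \<in> L" for \<Delta>
      proof -
        \<comment> \<open>A combination of \<open>\<Delta>0\<close> and \<open>\<Delta>\<close> over
          \<open>R\<close> that is chosen to vanish at \<open>?f\<close>.\<close>
        let ?\<Gamma> = "\<lambda>y. \<Delta> ?f \<otimes> \<Delta>0 y \<oplus> (\<ominus> w) \<otimes> \<Delta> y"
        have "?\<Gamma> \<in> L"
          unfolding L_def
        proof (intro CollectI conjI ballI)
          show "?\<Gamma> \<in> diff_ops"
            using L[OF \<Delta>] \<Delta>0(1) w by (intro diff_ops.add diff_ops.mult) auto
          fix v assume "v \<in> ?V"
          then have "\<Delta> v \<in> P" "\<Delta>0 v \<in> P" using L(2)[OF \<Delta>] \<Delta>0(2) by auto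
          then show "?\<Gamma> v \<in> P"
            using P.I_l_closed L(4)[OF \<Delta>] w by (intro P.a_closed) auto
        qed
        moreover have "?\<Gamma> ?f = \<zero>"
          using L(4)[OF \<Delta>] w by (simp add: w_def[symmetric] l_minus m_comm r_neg)
        ultimately have "?\<Gamma> x \<in> P" using kill[of ?\<Gamma>] by simp
        then show ?thesis
          using L(3)[OF \<Delta>] w(1) by (simp add: u_def a_minus_def l_minus)
      qed
      have "constant_fraction P u w"
        unfolding constant_fraction_def
      proof
        fix i assume i: "i \<in> K"
        have "(\<lambda>y. D i (\<Delta>0 y)) \<in> L"
          using \<Delta>0 i P(2) by (auto simp: L_def stable_def intro: diff_ops.deriv)
        from rel[OF this] have "D i w \<otimes> u \<ominus> w \<otimes> D i u \<in> P" by (simp add: w_def u_def)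
        then have "\<ominus> (D i w \<otimes> u \<ominus> w \<otimes> D i u) \<in> P" by simp
        moreover have "\<ominus> (D i w \<otimes> u \<ominus> w \<otimes> D i u) = w \<otimes> D i u \<ominus> u \<otimes> D i w"
          using D_closed[OF i w(1)] D_closed[OF i u] w(1) u by algebra
        ultimately show "w \<otimes> D i u \<ominus> u \<otimes> D i w \<in> P" by simp
      qed
      then obtain c where c: "u \<ominus> sc c \<otimes> w \<in> P" using P(3) u w unfolding rational_def by blast
      \<comment> \<open>All operators in \<open>L\<close> kill \<open>?y\<close> modulo
        \<open>P\<close>, so the induction hypothesis puts it into the smaller span, and then
        \<open>x\<close> is in the larger one.\<close>
      let ?y = "x \<ominus> sc c \<otimes> ?f"
      have y: "?y \<in> carrier R" using Suc.prems f by simp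
      have "\<Delta> ?y \<in> P" if \<Delta>: "\<Delta> \<in> L" for \<Delta>
      proof -
        have "?y = x \<oplus> sc (- c) \<otimes> ?f" using f by (simp add: a_minus_def sc_minus l_minus)
        then have "\<Delta> ?y = \<Delta> x \<oplus> sc (- c) \<otimes> \<Delta> ?f"
          using L(1)[OF \<Delta>] Suc.prems(1) f by (simp add: diff_ops_add diff_ops_scale)
        then have "\<Delta> ?y = \<Delta> x \<ominus> sc c \<otimes> \<Delta> ?f"
          using L(3,4)[OF \<Delta>] by (simp add: a_minus_def sc_minus l_minus)
        then have "w \<otimes> \<Delta> ?y = \<Delta> ?f \<otimes> (u \<ominus> sc c \<otimes> w) \<ominus> (\<Delta> ?f \<otimes> u \<ominus> w \<otimes> \<Delta> x)"
          apply (simp only:)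
          using L(3,4)[OF \<Delta>] w(1) u sc_closed[of c] by algebra
        also have "\<dots> \<in> P"
          using P.minus_closed[OF P.I_l_closed[OF c L(4)[OF \<Delta>]] rel[OF \<Delta>]] .
        finally show ?thesis
          using P.I_prime[of w "\<Delta> ?y"] w diff_ops_closed[OF L(1)[OF \<Delta>] y] by blast
      qed
      then have "?y \<in> ?V" using Suc.IH[OF y] unfolding L_def by blast
      moreover have "x = ?y \<oplus> sc c \<otimes> ?f"
        using Suc.prems(1) f sc_closed[of c] by algebra
      ultimately have "x \<in> lspan P e (Suc n)" unfolding lspan.simps by blast
      then show False using Suc.prems by blast
    qed
  qed
qed

text \<open>If \<open>e n\<close> enlarges the span, some operator \<open>\<Delta>\<close> kills
  \<open>lspan P e n\<close> modulo \<open>P\<close> but not \<open>e n\<close>, and the old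
  \<open>w\<close> is multiplied by \<open>\<Delta> (e n)\<close>. Applying \<open>\<Delta>\<close>
  to an element \<open>v + c e n\<close> of \<open>Q\<close> shows that
  \<open>c \<Delta> (e n)\<close> is in \<open>Q\<close>, so \<open>c = 0\<close>.\<close>

lemma stable_lspan_bound:
  assumes P: "primeideal P R" "stable P" "rational P" and e: "range e \<subseteq> carrier R"
  shows "\<exists>w\<in>carrier R - P. \<forall>Q. stable Q \<longrightarrow> P \<subseteq> Q \<longrightarrow> w \<notin> Q \<longrightarrow> Q \<inter> lspan P e n \<subseteq> P"
proof (induction n)
  interpret P: primeideal P R by (fact P(1))
  note Pid = P.is_ideal
  {
    case 0
    show ?case using P.one_notin by (intro bexI[of _ \<one>]) auto
  next
    case (Suc n)
    then obtain w where w: "w \<in> carrier R - P"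
      "\<And>Q. stable Q \<Longrightarrow> P \<subseteq> Q \<Longrightarrow> w \<notin> Q \<Longrightarrow> Q \<inter> lspan P e n \<subseteq> P" by blast
    have f: "e n \<in> carrier R" using e by blast
    show ?case
    proof (cases "e n \<in> lspan P e n")
      case True
      then have "lspan P e (Suc n) \<subseteq> lspan P e n"
        using lspan_add[OF Pid e] lspan_scale[OF Pid e] by auto
      then show ?thesis using w by blast
    next
      case False
      then obtain \<Delta> where \<Delta>: "\<Delta> \<in> diff_ops" "\<And>v. v \<in> lspan P e n \<Longrightarrow> \<Delta> v \<in> P" "\<Delta> (e n) \<notin> P"
        using diff_ops_separate[OF P e f] by blast
      let ?t = "\<Delta> (e n)"
      have t: "?t \<in> carrier R" using diff_ops_closed[OF \<Delta>(1) f] .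
      have "w \<otimes> ?t \<in> carrier R - P" using P.I_prime[of w ?t] w(1) t \<Delta>(3) by auto
      moreover have "Q \<inter> lspan P e (Suc n) \<subseteq> P"
        if Q: "stable Q" "P \<subseteq> Q" "w \<otimes> ?t \<notin> Q" for Q
      proof
        interpret Q: ideal Q R using Q(1) by (simp add: stable_def)
        have wt: "w \<notin> Q" "?t \<notin> Q" using Q(3) w(1) t Q.I_l_closed Q.I_r_closed by auto
        fix x assume x: "x \<in> Q \<inter> lspan P e (Suc n)"
        then obtain v c where v: "x = v \<oplus> sc c \<otimes> e n" "v \<in> lspan P e n" by auto
        have vc: "v \<in> carrier R" using v lspan_subset[OF Pid e] by blast
        have "\<Delta> x \<in> Q" using diff_ops_stable[OF \<Delta>(1) Q(1)] x by blast
        moreover have \<Delta>x: "\<Delta> x = \<Delta> v \<oplus> sc c \<otimes> ?t"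
          using vc f by (simp add: v(1) diff_ops_add[OF \<Delta>(1)] diff_ops_scale[OF \<Delta>(1)])
        moreover have "\<Delta> v \<in> Q" using \<Delta>(2)[OF v(2)] Q(2) by blast
        moreover have "\<Delta> x \<ominus> \<Delta> v = sc c \<otimes> ?t"
          unfolding \<Delta>x using diff_ops_closed[OF \<Delta>(1) vc] t sc_closed[of c] by algebra
        ultimately have "sc c \<otimes> ?t \<in> Q" using Q.minus_closed[of "\<Delta> x" "\<Delta> v"] by metis
        then have "c = 0" using sc_mult_mem_iff[OF Q.is_ideal _ t] wt by blast
        then have "x = v" using v vc f by simp
        then show "x \<in> P" using w(2)[OF Q(1,2) wt(1)] x v by blast
      qed
      ultimately show ?thesis by blast
    qed
  }
qed

end

locale countable_differential_algebra = countable_complex_algebra + differential_algebra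
begin

text \<open>One witness is taken for each span in the exhaustion of \<open>R\<close>; together they
  control all elements of \<open>Q\<close>.\<close>

lemma rational_countable_witnesses:
  assumes P: "primeideal P R" "stable P" "rational P"
  obtains w :: "nat \<Rightarrow> 'a" where "range w \<subseteq> carrier R - P"
    "\<And>Q. stable Q \<Longrightarrow> P \<subseteq> Q \<Longrightarrow> range w \<inter> Q = {} \<Longrightarrow> Q = P"
proof -
  obtain w where w: "\<And>n. w n \<in> carrier R - P"
    "\<And>n Q. stable Q \<Longrightarrow> P \<subseteq> Q \<Longrightarrow> w n \<notin> Q \<Longrightarrow> Q \<inter> lspan P e n \<subseteq> P"
    using stable_lspan_bound[OF P e_subset] by metis
  show thesis
  proof (rule that[of w])
    fix Q assume Q: "stable Q" "P \<subseteq> Q" "range w \<inter> Q = {}"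
    have "x \<in> P" if "x \<in> Q" for x
    proof -
      have "x \<in> carrier R" using Q(1) that by (auto simp: stable_def ideal_iff_closed)
      then obtain n where "x \<in> lspan P e n"
        using in_lspan[of P x] P(2) unfolding stable_def by blast
      moreover have "w n \<notin> Q" using Q(3) by blast
      ultimately show ?thesis using w(2)[OF Q(1,2)] that by blast
    qed
    then show "Q = P" using Q(2) by blast
  qed (use w(1) in auto)
qed

end

section \<open>Poisson algebras as differential algebras\<close>

text \<open>The sequence enumerates the monomials in the generators. The elements that multiply the
  span \<open>U\<close> of the monomials into itself form a subring containing the scalars and
  \<open>F\<close>, hence are everything; and \<open>\<one>\<close> is in \<open>U\<close>.\<close>

lemma (in complex_algebra) countable_complex_algebra_of_generators:
  assumes F: "countable F" "F \<subseteq> carrier R" "generate_ring R (range sc \<union> F) = carrier R"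
  shows "\<exists>e. countable_complex_algebra R sc e"
proof -
  define Mon where "Mon = (\<lambda>xs. foldr (\<otimes>) xs \<one>) ` lists F"
  have "countable Mon" using F by (simp add: Mon_def)
  moreover have "\<one> \<in> Mon" unfolding Mon_def by (rule image_eqI[of _ _ "[]"]) auto
  \<comment> \<open>The sequence has range \<open>Mon\<close>, with repetitions if
    \<open>Mon\<close> is finite; this uses that \<open>Mon\<close> is nonempty and
    countable.\<close>
  moreover define e where "e = from_nat_into Mon"
  ultimately have e: "range e = Mon" by (auto intro!: range_from_nat_into)
  have mult: "f \<otimes> m \<in> Mon" if f: "f \<in> F" and m: "m \<in> Mon" for f m
  proof -
    obtain xs where "xs \<in> lists F" "m = foldr (\<otimes>) xs \<one>" using m unfolding Mon_def by blast
    then show ?thesis unfolding Mon_def using f by (intro image_eqI[of _ _ "f # xs"]) auto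
  qed
  have "foldr (\<otimes>) xs \<one> \<in> carrier R" if "xs \<in> lists F" for xs
    using that F(2) by induction auto
  then have car: "range e \<subseteq> carrier R" using e by (auto simp: Mon_def)
  note id = zeroideal
  define U where "U = (\<Union>n. lspan {\<zero>} e n)"
  have Uc: "U \<subseteq> carrier R" using lspan_subset[OF id car] by (auto simp: U_def)
  have add: "x \<oplus> y \<in> U" if xy: "x \<in> U" "y \<in> U" for x y
  proof -
    obtain m n where mn: "x \<in> lspan {\<zero>} e m" "y \<in> lspan {\<zero>} e n" using xy by (auto simp: U_def)
    have "x \<in> lspan {\<zero>} e (max m n)" "y \<in> lspan {\<zero>} e (max m n)"
      using mn lspan_mono[OF id car max.cobounded1] lspan_mono[OF id car max.cobounded2] by blast+
    then show ?thesis using lspan_add[OF id car] by (auto simp: U_def)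
  qed
  have scale: "sc c \<otimes> x \<in> U" if "x \<in> U" for c x
    using that lspan_scale[OF id car] by (auto simp: U_def)
  have MonU: "m \<in> U" if "m \<in> Mon" for m
  proof -
    have "m \<in> range e" using that e by simp
    then obtain n where n: "m = e n" ..
    have "m \<in> carrier R" using car n by blast
    then have "m \<in> lspan {\<zero>} e (Suc n)"
      using basis_in_lspan[OF id car, of 1 n] n by (simp del: lspan.simps)
    then show ?thesis unfolding U_def by (rule UN_I[OF UNIV_I])
  qed
  have gen: "f \<otimes> x \<in> U" if f: "f \<in> F" and x: "x \<in> U" for f x
  proof -
    have fc: "f \<in> carrier R" using f F by blast
    have "f \<otimes> x \<in> U" if "x \<in> lspan {\<zero>} e n" for n
      using that
    proof (induction n arbitrary: x)
      case 0
      then have "f \<otimes> x \<in> lspan {\<zero>} e 0" using fc by simp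
      then show ?case unfolding U_def by (rule UN_I[OF UNIV_I])
    next
      case (Suc n)
      then obtain v c where v: "x = v \<oplus> sc c \<otimes> e n" "v \<in> lspan {\<zero>} e n" by auto
      have "v \<in> carrier R" "e n \<in> carrier R" using v lspan_subset[OF id car] car by blast+
      then have "f \<otimes> x = f \<otimes> v \<oplus> sc c \<otimes> (f \<otimes> e n)"
        using fc by (simp add: v(1) r_distr m_lcomm)
      moreover have "f \<otimes> e n \<in> U" using MonU mult f e by blast
      ultimately show ?case using add scale Suc.IH[OF v(2)] by simp
    qed
    then show ?thesis using x by (auto simp: U_def)
  qed
  have *: "b \<in> carrier R \<and> (\<forall>x\<in>U. b \<otimes> x \<in> U)" if "b \<in> generate_ring R (range sc \<union> F)" for b
    using that
  proof (induction rule: generate_ring.induct)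
    case one
    then show ?case using Uc by auto
  next
    case (incl h)
    then show ?case using gen scale F(2) by auto
  next
    case (a_inv h)
    have "\<ominus> h \<otimes> x = sc (-1) \<otimes> (h \<otimes> x)" if "x \<in> U" for x
      using a_inv.IH that Uc by (auto simp: sc_minus l_minus)
    then show ?case using a_inv scale by auto
  next
    case (eng_add h1 h2)
    have "(h1 \<oplus> h2) \<otimes> x = h1 \<otimes> x \<oplus> h2 \<otimes> x" if "x \<in> U" for x
      using eng_add.IH that Uc by (auto simp: l_distr)
    then show ?case using eng_add add by auto
  next
    case (eng_mult h1 h2)
    have "(h1 \<otimes> h2) \<otimes> x = h1 \<otimes> (h2 \<otimes> x)" if "x \<in> U" for x
      using eng_mult.IH that Uc by (auto simp: m_assoc)
    then show ?case using eng_mult by auto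
  qed
  have "x \<in> U" if "x \<in> carrier R" for x
    using *[of x] F(3) that MonU[OF \<open>\<one> \<in> Mon\<close>] by force
  then have "countable_complex_algebra R sc e"
    using car by unfold_locales (auto simp: U_def)
  then show ?thesis by (rule exI[of _ e])
qed

context poisson_algebra
begin

abbreviation scalar :: "complex \<Rightarrow> 'a" where
  "scalar c \<equiv> c \<odot> \<one>"

lemma complex_smult:
  "x \<in> carrier A \<Longrightarrow> c \<odot> x \<in> carrier A"
  "x \<in> carrier A \<Longrightarrow> (c + d) \<odot> x = c \<odot> x \<oplus> d \<odot> x"
  "x \<in> carrier A \<Longrightarrow> (c * d) \<odot> x = c \<odot> (d \<odot> x)"
  "x \<in> carrier A \<Longrightarrow> y \<in> carrier A \<Longrightarrow> c \<odot> (x \<oplus> y) = c \<odot> x \<oplus> c \<odot> y"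
  "x \<in> carrier A \<Longrightarrow> 1 \<odot> x = x"
  "x \<in> carrier A \<Longrightarrow> y \<in> carrier A \<Longrightarrow> (c \<odot> x) \<otimes> y = c \<odot> (x \<otimes> y)"
  using smult_closed[of c x] smult_l_distr[of c d x] smult_assoc1[of c d x] smult_one[of x]
    smult_r_distr[of c x y] smult_assoc2[of c x y]
  by (simp_all add: ring_of_type_algebra_def)

lemma smult_eq_scalar_mult:
  assumes "x \<in> carrier A" shows "c \<odot> x = scalar c \<otimes> x"
proof -
  interpret cring A by (rule M_cring)
  show ?thesis using complex_smult(6)[of \<one> x c] assms by simp
qed

lemma pbracket_one:
  assumes "x \<in> carrier A" shows "\<lbrace>\<one>, x\<rbrace> = \<zero>" "\<lbrace>x, \<one>\<rbrace> = \<zero>"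
proof -
  interpret cring A by (rule M_cring)
  show "\<lbrace>\<one>, x\<rbrace> = \<zero>" "\<lbrace>x, \<one>\<rbrace> = \<zero>"
    using pbracket_Leibniz_left[of \<one> \<one> x] pbracket_Leibniz_right[of x \<one> \<one>] assms
    by (simp_all add: add.l_cancel_one)
qed

lemma pbracket_scalar:
  assumes "x \<in> carrier A" shows "\<lbrace>scalar c, x\<rbrace> = \<zero>"
proof -
  interpret cring A by (rule M_cring)
  have "\<lbrace>scalar c, x\<rbrace> = c \<odot> \<zero>" using pbracket_smult_left[of \<one> x c] pbracket_one[OF assms] assms by simp
  also have "\<dots> = \<zero>"
    using complex_smult(4)[of \<zero> \<zero> c] complex_smult(1)[of \<zero> c]
    by (simp add: add.l_cancel_one)
  finally show ?thesis .
qed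

lemma differential_algebra: "differential_algebra A scalar (carrier A) (\<lambda>y x. \<lbrace>x, y\<rbrace>)"
proof -
  interpret cring A by (rule M_cring)
  show ?thesis
  proof unfold_locales
    show "scalar (a + b) = scalar a \<oplus> scalar b" for a b
      by (simp add: complex_smult)
    show "scalar (a * b) = scalar a \<otimes> scalar b" for a b
      by (simp add: complex_smult)
  qed (auto simp: complex_smult pbracket_add_left pbracket_Leibniz_left pbracket_scalar)
qed

end

lemma (in affine_poisson_algebra) countable_differential_algebra:
  "\<exists>e. countable_differential_algebra A scalar e (carrier A) (\<lambda>y x. \<lbrace>x, y\<rbrace>)"
proof -
  interpret D: differential_algebra A scalar "carrier A" "\<lambda>y x. \<lbrace>x, y\<rbrace>"
    by (rule differential_algebra)
  obtain F where F: "finite F" "F \<subseteq> carrier A"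
    "generate_ring A (range scalar \<union> F) = carrier A"
    using finitely_generated by blast
  from D.countable_complex_algebra_of_generators[OF countable_finite[OF F(1)] F(2,3)]
  obtain e where "countable_complex_algebra A scalar e" ..
  then have "countable_differential_algebra A scalar e (carrier A) (\<lambda>y x. \<lbrace>x, y\<rbrace>)"
    by (rule countable_differential_algebra.intro) (rule differential_algebra)
  then show ?thesis by (rule exI[of _ e])
qed

context poisson_algebra
begin

subsection \<open>Rationality in terms of the algebra itself\<close>

text \<open>The bracket of \<open>a / b\<close> with \<open>x\<close> is
  \<open>(b {a, x} - a {b, x}) / b^2\<close>, and its bracket with \<open>c / d\<close> is
  determined by those with \<open>c\<close> and \<open>d\<close>. So centrality can be tested on the
  algebra itself.\<close>

lemma poisson_center_frac_eq_iff:
  assumes "domain A"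
  defines "F \<equiv> poisson_frac A"
  shows "poisson_center F = range (\<lambda>c. c \<odot>\<^bsub>F\<^esub> \<one>\<^bsub>F\<^esub>) \<longleftrightarrow>
    (\<forall>a\<in>carrier A. \<forall>b\<in>carrier A - {\<zero>}.
      (\<forall>x\<in>carrier A. b \<otimes> \<lbrace>a, x\<rbrace> = a \<otimes> \<lbrace>b, x\<rbrace>) \<longrightarrow> (\<exists>c. a = c \<odot> b))"
proof -
  interpret domain A by fact
  note [simp] = complex_smult
  have carr: "carrier F = {fraction A a b | a b. a \<in> carrier A \<and> b \<in> carrier A - {\<zero>}}"
    unfolding F_def poisson_frac_def fraction_def quotient_def by auto
  have zero: "\<zero>\<^bsub>F\<^esub> = fraction A \<zero> \<one>" and one: "\<one>\<^bsub>F\<^esub> = fraction A \<one> \<one>"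
    by (simp_all add: F_def poisson_frac_def)
  have scalar: "c \<odot>\<^bsub>F\<^esub> \<one>\<^bsub>F\<^esub> = fraction A (scalar c) \<one>" for c
  proof -
    have eq: "fraction A (c \<odot> a) b = fraction A (scalar c) \<one>" if "(a, b) \<in> fraction A \<one> \<one>" for a b
    proof -
      have "a \<in> carrier A" "b \<in> carrier A" "a = b" "b \<noteq> \<zero>"
        using that by (auto simp: fraction_def frac_rel_def)
      then show ?thesis by (simp add: fraction_eq_iff)
    qed
    have "(\<one>, \<one>) \<in> fraction A \<one> \<one>" by (auto simp: fraction_def frac_rel_def)
    then have "fraction A \<one> \<one> \<noteq> {}" by blast
    moreover have "(\<Union>(a, b)\<in>fraction A \<one> \<one>. fraction A (c \<odot> a) b) =
        (\<Union>_\<in>fraction A \<one> \<one>. fraction A (scalar c) \<one>)"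
      by (rule SUP_cong[OF refl], clarify) (rule eq)
    ultimately have "(\<Union>(a, b)\<in>fraction A \<one> \<one>. fraction A (c \<odot> a) b) = fraction A (scalar c) \<one>"
      by (simp only: UN_constant if_False)
    then show ?thesis by (simp add: F_def poisson_frac_def)
  qed
  have central: "fraction A a b \<in> poisson_center F \<longleftrightarrow> (\<forall>x\<in>carrier A. b \<otimes> \<lbrace>a, x\<rbrace> = a \<otimes> \<lbrace>b, x\<rbrace>)"
    if ab: "a \<in> carrier A" "b \<in> carrier A - {\<zero>}" for a b
  proof -
    have br: "\<lbrace>fraction A a b, fraction A c d\<rbrace>\<^bsub>F\<^esub> = \<zero>\<^bsub>F\<^esub> \<longleftrightarrow>
        d \<otimes> (b \<otimes> \<lbrace>a, c\<rbrace> \<ominus> a \<otimes> \<lbrace>b, c\<rbrace>) \<ominus> c \<otimes> (b \<otimes> \<lbrace>a, d\<rbrace> \<ominus> a \<otimes> \<lbrace>b, d\<rbrace>) = \<zero>"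
      if cd: "c \<in> carrier A" "d \<in> carrier A - {\<zero>}" for c d
      unfolding zero
      using pbracket_frac[OF assms(1) ab cd] ab cd
      by (simp add: F_def fraction_eq_iff integral_iff)
    show ?thesis
    proof
      assume f: "fraction A a b \<in> poisson_center F"
      show "\<forall>x\<in>carrier A. b \<otimes> \<lbrace>a, x\<rbrace> = a \<otimes> \<lbrace>b, x\<rbrace>"
      proof
        fix x assume x: "x \<in> carrier A"
        then have "fraction A x \<one> \<in> carrier F" unfolding carr using one_not_zero one_closed by blast
        then have "\<lbrace>fraction A a b, fraction A x \<one>\<rbrace>\<^bsub>F\<^esub> = \<zero>\<^bsub>F\<^esub>"
          using f by (simp add: poisson_center_def)
        then show "b \<otimes> \<lbrace>a, x\<rbrace> = a \<otimes> \<lbrace>b, x\<rbrace>"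
          using br[of x \<one>] x ab by (simp add: pbracket_one a_minus_def[of _ \<zero>] r_right_minus_eq)
      qed
    next
      assume eq: "\<forall>x\<in>carrier A. b \<otimes> \<lbrace>a, x\<rbrace> = a \<otimes> \<lbrace>b, x\<rbrace>"
      have "\<lbrace>fraction A a b, fraction A c d\<rbrace>\<^bsub>F\<^esub> = \<zero>\<^bsub>F\<^esub>"
        if cd: "c \<in> carrier A" "d \<in> carrier A - {\<zero>}" for c d
        using br[OF cd] eq ab cd by (simp add: a_minus_def r_neg)
      then show "fraction A a b \<in> poisson_center F"
        unfolding poisson_center_def carr using ab by blast
    qed
  qed
  have range_iff: "fraction A a b \<in> range (\<lambda>c. c \<odot>\<^bsub>F\<^esub> \<one>\<^bsub>F\<^esub>) \<longleftrightarrow> (\<exists>c. a = c \<odot> b)"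
    if ab: "a \<in> carrier A" "b \<in> carrier A - {\<zero>}" for a b
    unfolding scalar image_iff using ab by (simp add: fraction_eq_iff)
  have sub: "range (\<lambda>c. c \<odot>\<^bsub>F\<^esub> \<one>\<^bsub>F\<^esub>) \<subseteq> poisson_center F"
    unfolding scalar using central by (auto simp: pbracket_one pbracket_scalar)
  have "poisson_center F \<subseteq> carrier F" by (auto simp: poisson_center_def)
  then have "poisson_center F = range (\<lambda>c. c \<odot>\<^bsub>F\<^esub> \<one>\<^bsub>F\<^esub>) \<longleftrightarrow>
      (\<forall>a\<in>carrier A. \<forall>b\<in>carrier A - {\<zero>}.
        fraction A a b \<in> poisson_center F \<longrightarrow> fraction A a b \<in> range (\<lambda>c. c \<odot>\<^bsub>F\<^esub> \<one>\<^bsub>F\<^esub>))"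
    using sub unfolding carr by blast
  also have "\<dots> \<longleftrightarrow> (\<forall>a\<in>carrier A. \<forall>b\<in>carrier A - {\<zero>}.
      (\<forall>x\<in>carrier A. b \<otimes> \<lbrace>a, x\<rbrace> = a \<otimes> \<lbrace>b, x\<rbrace>) \<longrightarrow> (\<exists>c. a = c \<odot> b))"
    by (intro ball_cong refl imp_cong central range_iff)
  finally show ?thesis .
qed

end

section \<open>Quotients by Poisson ideals\<close>

context poisson_algebra
begin

context
  fixes I Q assumes I: "poisson_ideal A I"
  defines "Q \<equiv> poisson_quot A I"
begin

interpretation I: ideal I A using I by (simp add: poisson_ideal_def)

lemma carrier_poisson_quot: "carrier Q = (\<lambda>x. I +> x) ` carrier A"
  by (auto simp: Q_def poisson_quot_def FactRing_def A_RCOSETS_def')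

lemma poisson_quot_zero: "I +> \<zero> = \<zero>\<^bsub>Q\<^esub>"
  using ring.a_rcos_zero[OF cring.axioms(1)[OF M_cring] I.is_ideal I.zero_closed]
  by (simp add: Q_def poisson_quot_def FactRing_def)

lemma poisson_quot_coset_eq_iff:
  "x \<in> carrier A \<Longrightarrow> y \<in> carrier A \<Longrightarrow> I +> x = I +> y \<longleftrightarrow> x \<ominus> y \<in> I"
  using ring.quotient_eq_iff_same_a_r_cos[OF cring.axioms(1)[OF M_cring] I.is_ideal] by metis

lemma poisson_quot_smult:
  assumes x: "x \<in> carrier A" shows "c \<odot>\<^bsub>Q\<^esub> (I +> x) = I +> c \<odot> x"
proof -
  interpret cring A by (rule M_cring)
  have eq: "I +> c \<odot> y = I +> c \<odot> x" if "y \<in> I +> x" for y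
  proof -
    have y: "y \<in> carrier A" using that x M.a_r_coset_subset_G[OF I.a_subset] by blast
    have "I +> x = I +> y" using that x by (rule M.a_repr_independence[OF _ _ I.a_subgroup])
    then have "y \<ominus> x \<in> I" using poisson_quot_coset_eq_iff[OF y x] by simp
    then have "scalar c \<otimes> (y \<ominus> x) \<in> I" using I.I_l_closed complex_smult(1)[OF one_closed] by blast
    moreover have "scalar c \<otimes> (y \<ominus> x) = c \<odot> y \<ominus> c \<odot> x"
    proof -
      have "scalar c \<in> carrier A" by (simp add: complex_smult)
      then show ?thesis
        unfolding smult_eq_scalar_mult[OF x] smult_eq_scalar_mult[OF y] using x y by algebra
    qed
    ultimately show ?thesis using poisson_quot_coset_eq_iff x y complex_smult(1) by simp
  qed
  have "I +> x \<noteq> {}" using I.a_rcos_self[OF x] by blast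
  moreover have "(\<Union>y\<in>I +> x. I +> c \<odot> y) = (\<Union>_\<in>I +> x. I +> c \<odot> x)"
    by (rule SUP_cong[OF refl]) (rule eq)
  ultimately have "(\<Union>y\<in>I +> x. I +> c \<odot> y) = I +> c \<odot> x"
    by (simp only: UN_constant if_False)
  then show ?thesis by (simp add: Q_def poisson_quot_def)
qed

lemma poisson_quot_ops:
  assumes "x \<in> carrier A" "y \<in> carrier A"
  shows "(I +> x) \<oplus>\<^bsub>Q\<^esub> (I +> y) = I +> (x \<oplus> y)" "(I +> x) \<otimes>\<^bsub>Q\<^esub> (I +> y) = I +> (x \<otimes> y)"
    "\<lbrace>I +> x, I +> y\<rbrace>\<^bsub>Q\<^esub> = I +> \<lbrace>x, y\<rbrace>"
  using I.a_rcos_sum I.rcoset_mult_add pbracket_quot[OF I] assms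
  by (auto simp: Q_def poisson_quot_def FactRing_def)

text \<open>Being a commutative ring depends only on the carrier and the ring operations, which
  \<open>Q\<close> shares with \<open>A Quot I\<close>.\<close>

lemma cring_poisson_quot: "cring Q"
proof -
  have "cring Q \<longleftrightarrow> cring (A Quot I)"
    unfolding Q_def poisson_quot_def cring_def ring_def ring_axioms_def abelian_group_def
      abelian_group_axioms_def abelian_monoid_def comm_group_def comm_monoid_def
      comm_monoid_axioms_def group_def group_axioms_def monoid_def Units_def
    by (simp only: partial_object.simps monoid.simps ring.simps module.simps poisson_alg.simps)
  then show ?thesis using I.quotient_is_cring[OF M_cring] by simp
qed

lemma poisson_algebra_poisson_quot: "poisson_algebra Q"
proof -
  interpret cring A by (rule M_cring)
  note simps = carrier_poisson_quot poisson_quot_ops poisson_quot_smult complex_smult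
  have "algebra complex_ring Q"
  proof (rule algebraI)
    show "cring complex_ring" by (rule R_cring)
    show "cring Q" by (rule cring_poisson_quot)
  qed (auto simp: simps ring_of_type_algebra_def)
  then show ?thesis
  proof (rule poisson_algebra.intro)
    show "poisson_algebra_axioms Q"
      by unfold_locales
        (auto simp: simps poisson_quot_zero[symmetric] pbracket_Jacobi pbracket_add_left
          pbracket_add_right pbracket_smult_left pbracket_smult_right
          pbracket_Leibniz_left pbracket_Leibniz_right)
  qed
qed

lemma domain_poisson_quot:
  assumes "primeideal I A" shows "domain Q"
proof -
  have "domain (A Quot I)" using assms by (rule primeideal.quotient_is_domain)
  then have "domain_axioms (A Quot I)" by (rule domain.axioms)
  then have "domain_axioms Q"
    unfolding domain_axioms_def by (simp add: Q_def poisson_quot_def)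
  then show ?thesis using cring_poisson_quot by (simp add: domain_def)
qed

end

lemma poisson_ideal_iff_stable:
  "poisson_ideal A I \<longleftrightarrow> differential_algebra.stable A (carrier A) (\<lambda>y x. \<lbrace>x, y\<rbrace>) I"
  unfolding differential_algebra.stable_def[OF differential_algebra] poisson_ideal_def by blast

text \<open>The criterion for the center of the fraction field is applied to \<open>A / P\<close>
  and pulled back to \<open>A\<close>, where an equality of cosets becomes membership of a
  difference in \<open>P\<close>.\<close>

lemma poisson_rational_iff:
  assumes "P \<in> poisson_spec A"
  shows "poisson_rational A P \<longleftrightarrow>
    differential_algebra.rational A scalar (carrier A) (\<lambda>y x. \<lbrace>x, y\<rbrace>) P"
proof -
  interpret cring A by (rule M_cring)
  interpret P: primeideal P A using assms by (simp add: poisson_spec_def)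
  have P: "poisson_ideal A P" using assms by (simp add: poisson_spec_def)
  let ?Q = "poisson_quot A P"
  have eq: "P +> x = P +> y \<longleftrightarrow> x \<ominus> y \<in> P" if "x \<in> carrier A" "y \<in> carrier A" for x y
    using poisson_quot_coset_eq_iff[OF P] that .
  have nonzero: "P +> b \<noteq> \<zero>\<^bsub>?Q\<^esub> \<longleftrightarrow> b \<notin> P" if "b \<in> carrier A" for b
    unfolding poisson_quot_zero[OF P, symmetric] using eq[OF that zero_closed] that
    by (simp add: a_minus_def)
  have ball_carrier: "(\<forall>U\<in>carrier ?Q. \<phi> U) \<longleftrightarrow> (\<forall>a\<in>carrier A. \<phi> (P +> a))" for \<phi>
    unfolding carrier_poisson_quot[OF P] by (rule ball_simps)
  have ball_carrier_nonzero:
    "(\<forall>V\<in>carrier ?Q - {\<zero>\<^bsub>?Q\<^esub>}. \<phi> V) \<longleftrightarrow> (\<forall>b\<in>carrier A - P. \<phi> (P +> b))" for \<phi>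
    unfolding carrier_poisson_quot[OF P] using nonzero by (auto simp: ball_simps)
  have body: "((\<forall>x\<in>carrier A. (P +> b) \<otimes>\<^bsub>?Q\<^esub> \<lbrace>P +> a, P +> x\<rbrace>\<^bsub>?Q\<^esub> =
        (P +> a) \<otimes>\<^bsub>?Q\<^esub> \<lbrace>P +> b, P +> x\<rbrace>\<^bsub>?Q\<^esub>) \<longrightarrow> (\<exists>c. P +> a = c \<odot>\<^bsub>?Q\<^esub> (P +> b))) \<longleftrightarrow>
      ((\<forall>x\<in>carrier A. b \<otimes> \<lbrace>a, x\<rbrace> \<ominus> a \<otimes> \<lbrace>b, x\<rbrace> \<in> P) \<longrightarrow> (\<exists>c. a \<ominus> scalar c \<otimes> b \<in> P))"
    if ab: "a \<in> carrier A" "b \<in> carrier A" for a b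
  proof (intro imp_cong ball_cong ex_cong1 refl)
    fix x assume "x \<in> carrier A"
    then show "(P +> b) \<otimes>\<^bsub>?Q\<^esub> \<lbrace>P +> a, P +> x\<rbrace>\<^bsub>?Q\<^esub> = (P +> a) \<otimes>\<^bsub>?Q\<^esub> \<lbrace>P +> b, P +> x\<rbrace>\<^bsub>?Q\<^esub> \<longleftrightarrow>
        b \<otimes> \<lbrace>a, x\<rbrace> \<ominus> a \<otimes> \<lbrace>b, x\<rbrace> \<in> P"
      using ab by (simp only: poisson_quot_ops[OF P] pbracket_closed) (rule eq; simp)
  next
    fix c
    have "scalar c \<otimes> b = c \<odot> b" using smult_eq_scalar_mult[OF ab(2)] by simp
    then show "P +> a = c \<odot>\<^bsub>?Q\<^esub> (P +> b) \<longleftrightarrow> a \<ominus> scalar c \<otimes> b \<in> P"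
      using eq[OF ab(1) complex_smult(1)[OF ab(2)]] by (simp only: poisson_quot_smult[OF P ab(2)])
  qed
  have "poisson_rational A P \<longleftrightarrow> (\<forall>U\<in>carrier ?Q. \<forall>V\<in>carrier ?Q - {\<zero>\<^bsub>?Q\<^esub>}.
      (\<forall>W\<in>carrier ?Q. V \<otimes>\<^bsub>?Q\<^esub> \<lbrace>U, W\<rbrace>\<^bsub>?Q\<^esub> = U \<otimes>\<^bsub>?Q\<^esub> \<lbrace>V, W\<rbrace>\<^bsub>?Q\<^esub>) \<longrightarrow> (\<exists>c. U = c \<odot>\<^bsub>?Q\<^esub> V))"
    unfolding poisson_rational_def Let_def
    by (rule poisson_algebra.poisson_center_frac_eq_iff[OF poisson_algebra_poisson_quot[OF P]
          domain_poisson_quot[OF P P.primeideal]])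
  also have "\<dots> \<longleftrightarrow> (\<forall>a\<in>carrier A. \<forall>b\<in>carrier A - P.
      (\<forall>x\<in>carrier A. b \<otimes> \<lbrace>a, x\<rbrace> \<ominus> a \<otimes> \<lbrace>b, x\<rbrace> \<in> P) \<longrightarrow> (\<exists>c. a \<ominus> scalar c \<otimes> b \<in> P))"
    unfolding ball_carrier ball_carrier_nonzero by (intro ball_cong refl) (simp add: body)
  finally show ?thesis
    unfolding differential_algebra.rational_def[OF differential_algebra]
      differential_algebra.constant_fraction_def[OF differential_algebra] .
qed

end

section \<open>A topological form of the equivalence\<close>

definition locally_gdelta_in :: "'a topology \<Rightarrow> 'a set \<Rightarrow> bool" where
  "locally_gdelta_in T S \<longleftrightarrow>
    (\<exists>C U. closedin T C \<and> (\<forall>n::nat. openin T (U n)) \<and> S = C \<inter> (\<Inter>n. U n))"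

lemma locally_closed_in_imp_gdelta: "locally_closed_in T S \<Longrightarrow> locally_gdelta_in T S"
  unfolding locally_closed_in_def locally_gdelta_in_def
  by (elim exE conjE, rename_tac U C, rule_tac x = C in exI, rule_tac x = "\<lambda>_. U" in exI) auto

lemma locally_closed_in_preimage:
  assumes "continuous_map T T' f" "locally_closed_in T' S"
  shows "locally_closed_in T {x \<in> topspace T. f x \<in> S}"
proof -
  obtain U C where "openin T' U" "closedin T' C" "S = U \<inter> C"
    using assms(2) by (auto simp: locally_closed_in_def)
  moreover from this have "openin T {x \<in> topspace T. f x \<in> U}" "closedin T {x \<in> topspace T. f x \<in> C}"
    using assms(1) openin_continuous_map_preimage closedin_continuous_map_preimage by blast+
  moreover have "{x \<in> topspace T. f x \<in> U \<inter> C} =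
      {x \<in> topspace T. f x \<in> U} \<inter> {x \<in> topspace T. f x \<in> C}" by blast
  ultimately show ?thesis unfolding locally_closed_in_def by blast
qed

lemma locally_gdelta_in_preimage:
  assumes "continuous_map T T' f" "locally_gdelta_in T' S"
  shows "locally_gdelta_in T {x \<in> topspace T. f x \<in> S}"
proof -
  obtain U C where U: "\<And>n::nat. openin T' (U n)" and C: "closedin T' C" and S: "S = C \<inter> (\<Inter>n. U n)"
    using assms(2) by (auto simp: locally_gdelta_in_def)
  have "openin T {x \<in> topspace T. f x \<in> U n}" for n
    using assms(1) U openin_continuous_map_preimage by blast
  moreover have "closedin T {x \<in> topspace T. f x \<in> C}"
    using assms(1) C closedin_continuous_map_preimage by blast
  moreover have "{x \<in> topspace T. f x \<in> S} =
      {x \<in> topspace T. f x \<in> C} \<inter> (\<Inter>n. {x \<in> topspace T. f x \<in> U n})"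
    using S by blast
  ultimately show ?thesis
    unfolding locally_gdelta_in_def
    by (intro exI[of _ "{x \<in> topspace T. f x \<in> C}"] exI[of _ "\<lambda>n. {x \<in> topspace T. f x \<in> U n}"]) blast
qed

text \<open>From the subspace to \<open>T\<close>, the sets cutting out \<open>Z\<close> are
  intersected with the open and the closed set that cut out \<open>S\<close>.\<close>

lemma locally_closed_in_subtopology:
  assumes S: "locally_closed_in T S" and Z: "Z \<subseteq> S"
  shows "locally_closed_in (subtopology T S) Z \<longleftrightarrow> locally_closed_in T Z"
proof
  obtain U0 C0 where S': "openin T U0" "closedin T C0" "S = U0 \<inter> C0"
    using S by (auto simp: locally_closed_in_def)
  assume "locally_closed_in (subtopology T S) Z"
  then obtain U C where "openin T U" "closedin T C" "Z = (U \<inter> S) \<inter> (C \<inter> S)"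
    unfolding locally_closed_in_def openin_subtopology closedin_subtopology by blast
  then have "openin T (U \<inter> U0)" "closedin T (C \<inter> C0)" "Z = (U \<inter> U0) \<inter> (C \<inter> C0)"
    using S' by auto
  then show "locally_closed_in T Z" unfolding locally_closed_in_def by blast
next
  assume "locally_closed_in T Z"
  then obtain U C where "openin T U" "closedin T C" "Z = U \<inter> C"
    unfolding locally_closed_in_def by blast
  then have "openin (subtopology T S) (U \<inter> S)" "closedin (subtopology T S) (C \<inter> S)"
    "Z = (U \<inter> S) \<inter> (C \<inter> S)"
    using Z unfolding openin_subtopology closedin_subtopology by blast+
  then show "locally_closed_in (subtopology T S) Z" unfolding locally_closed_in_def by blast
qed

lemma locally_gdelta_in_subtopology:
  assumes S: "locally_closed_in T S" and Z: "Z \<subseteq> S"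
  shows "locally_gdelta_in (subtopology T S) Z \<longleftrightarrow> locally_gdelta_in T Z"
proof
  obtain U0 C0 where S': "openin T U0" "closedin T C0" "S = U0 \<inter> C0"
    using S by (auto simp: locally_closed_in_def)
  assume "locally_gdelta_in (subtopology T S) Z"
  then obtain U C where U: "\<And>n::nat. openin (subtopology T S) (U n)"
    and C: "closedin (subtopology T S) C" and Z': "Z = C \<inter> (\<Inter>n. U n)"
    unfolding locally_gdelta_in_def by blast
  have "\<exists>V. openin T V \<and> U n = V \<inter> S" for n using U[of n] unfolding openin_subtopology .
  then obtain V where V: "\<And>n. openin T (V n)" "\<And>n. U n = V n \<inter> S" by metis
  obtain D where D: "closedin T D" "C = D \<inter> S" using C unfolding closedin_subtopology by blast
  have "openin T (V n \<inter> U0)" for n using V S' by blast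
  moreover have "closedin T (D \<inter> C0)" using D S' by blast
  moreover have "Z = (D \<inter> C0) \<inter> (\<Inter>n. V n \<inter> U0)" using Z' V(2) D(2) S'(3) by auto
  ultimately show "locally_gdelta_in T Z"
    unfolding locally_gdelta_in_def
    by (intro exI[of _ "D \<inter> C0"] exI[of _ "\<lambda>n. V n \<inter> U0"]) blast
next
  assume "locally_gdelta_in T Z"
  then obtain U C where U: "\<And>n::nat. openin T (U n)"
    and C: "closedin T C" and Z': "Z = C \<inter> (\<Inter>n. U n)"
    unfolding locally_gdelta_in_def by blast
  have "openin (subtopology T S) (U n \<inter> S)" for n
    using U[of n] unfolding openin_subtopology by blast
  moreover have "closedin (subtopology T S) (C \<inter> S)"
    using C unfolding closedin_subtopology by blast
  moreover have "Z = (C \<inter> S) \<inter> (\<Inter>n. U n \<inter> S)" using Z Z' by blast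
  ultimately show "locally_gdelta_in (subtopology T S) Z"
    unfolding locally_gdelta_in_def
    by (intro exI[of _ "C \<inter> S"] exI[of _ "\<lambda>n. U n \<inter> S"]) blast
qed

definition gdelta_points_locally_closed :: "'a topology \<Rightarrow> bool" where
  "gdelta_points_locally_closed T \<longleftrightarrow>
    (\<forall>x\<in>topspace T. locally_gdelta_in T {x} \<longrightarrow> locally_closed_in T {x})"

lemma gdelta_points_locally_closed_homeomorphic:
  assumes "T homeomorphic_space T'" "gdelta_points_locally_closed T"
  shows "gdelta_points_locally_closed T'"
  unfolding gdelta_points_locally_closed_def
proof (intro ballI impI)
  obtain f g where fg: "continuous_map T T' f" "continuous_map T' T g"
    "\<And>x. x \<in> topspace T \<Longrightarrow> g (f x) = x" "\<And>y. y \<in> topspace T' \<Longrightarrow> f (g y) = y"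
    using assms(1) unfolding homeomorphic_space_def homeomorphic_maps_def by blast
  fix y assume y: "y \<in> topspace T'" "locally_gdelta_in T' {y}"
  have gy: "g y \<in> topspace T" using continuous_map_funspace[OF fg(2)] y(1) by blast
  have "{x \<in> topspace T. f x \<in> {y}} = {g y}" using fg y(1) gy by auto
  then have "locally_gdelta_in T {g y}"
    using locally_gdelta_in_preimage[OF fg(1) y(2)] by simp
  then have "locally_closed_in T {g y}"
    using assms(2) gy unfolding gdelta_points_locally_closed_def by blast
  moreover have "{z \<in> topspace T'. g z \<in> {g y}} = {y}" using fg(4) y(1) by (auto, metis)
  ultimately show "locally_closed_in T' {y}"
    using locally_closed_in_preimage[OF fg(2), of "{g y}"] by simp
qed

text \<open>The property is a condition on single points, and both of its sides mean the same in a
  locally closed piece as in the whole space.\<close>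

lemma gdelta_points_locally_closed_cover:
  assumes cover: "topspace T = (\<Union>i\<in>I. S i)" and S: "\<And>i. i \<in> I \<Longrightarrow> locally_closed_in T (S i)"
  shows "gdelta_points_locally_closed T \<longleftrightarrow>
    (\<forall>i\<in>I. gdelta_points_locally_closed (subtopology T (S i)))"
proof -
  have "gdelta_points_locally_closed (subtopology T (S i)) \<longleftrightarrow>
      (\<forall>x\<in>S i. locally_gdelta_in T {x} \<longrightarrow> locally_closed_in T {x})" if "i \<in> I" for i
  proof -
    have "topspace (subtopology T (S i)) = S i" using cover that by auto
    then show ?thesis
      using S[OF that] unfolding gdelta_points_locally_closed_def
      by (simp add: locally_closed_in_subtopology locally_gdelta_in_subtopology)
  qed
  then show ?thesis using cover unfolding gdelta_points_locally_closed_def by auto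
qed

section \<open>The topology of the Poisson spectrum\<close>

lemma openin_poisson_spec:
  "openin (poisson_spec_topology A) U \<longleftrightarrow> (\<exists>S\<subseteq>carrier A. U = {P \<in> poisson_spec A. \<not> S \<subseteq> P})"
proof -
  have "({P. primeideal P A} - {P. primeideal P A \<and> S \<subseteq> P}) \<inter> poisson_spec A =
      {P \<in> poisson_spec A. \<not> S \<subseteq> P}" for S
    by (auto simp: poisson_spec_def)
  moreover have "(\<exists>V. (\<exists>S\<subseteq>carrier A. V = f S) \<and> U = h V) \<longleftrightarrow> (\<exists>S\<subseteq>carrier A. U = h (f S))"
    for f :: "'a set \<Rightarrow> 'a set set" and h by blast
  ultimately show ?thesis
    unfolding poisson_spec_topology_def openin_subtopology openin_zariski by simp
qed

lemma closedin_poisson_spec: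
  "closedin (poisson_spec_topology A) C \<longleftrightarrow> (\<exists>S\<subseteq>carrier A. C = {P \<in> poisson_spec A. S \<subseteq> P})"
proof -
  have *: "C \<subseteq> poisson_spec A \<and> poisson_spec A - C = {P \<in> poisson_spec A. \<not> S \<subseteq> P} \<longleftrightarrow>
      C = {P \<in> poisson_spec A. S \<subseteq> P}" for S by blast
  show ?thesis
    unfolding closedin_def topspace_poisson_spec openin_poisson_spec
    using * by (smt (verit, best))
qed

context affine_poisson_algebra
begin

lemma poisson_primitive_in_spec:
  assumes "poisson_primitive A P" shows "P \<in> poisson_spec A"
proof -
  interpret D: differential_algebra A scalar "carrier A" "\<lambda>y x. \<lbrace>x, y\<rbrace>"
    by (rule differential_algebra)
  obtain M where M: "maximalideal M A" "P = poisson_core A M"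
    using assms by (auto simp: poisson_primitive_def)
  have id: "ideal M A" using M(1) by (rule maximalideal.axioms(1))
  have "primeideal P A"
    using D.prime_of_greatest_stable[of M P] cring.maximalideal_prime[OF M_cring M(1)] poisson_core[OF id]
    unfolding M(2) poisson_ideal_iff_stable by blast
  then show ?thesis using poisson_core(1)[OF id] M(2) by (simp add: poisson_spec_def)
qed

text \<open>The residue field at a maximal ideal consists of scalars, and the core is the greatest
  stable ideal inside it, as \<open>rational_of_greatest_stable\<close> requires.\<close>

lemma poisson_primitive_imp_rational:
  assumes "poisson_primitive A P" shows "poisson_rational A P"
proof -
  obtain e where "countable_differential_algebra A scalar e (carrier A) (\<lambda>y x. \<lbrace>x, y\<rbrace>)"
    using countable_differential_algebra by (rule exE)
  then interpret D: countable_differential_algebra A scalar e "carrier A" "\<lambda>y x. \<lbrace>x, y\<rbrace>" .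
  obtain M where M: "maximalideal M A" "P = poisson_core A M"
    using assms by (auto simp: poisson_primitive_def)
  have id: "ideal M A" using M(1) by (rule maximalideal.axioms(1))
  have spec: "P \<in> poisson_spec A" using assms by (rule poisson_primitive_in_spec)
  note core = poisson_core[OF id, folded M(2), unfolded poisson_ideal_iff_stable]
  have residue: "\<exists>c. x \<ominus> scalar c \<in> M" if "x \<in> carrier A" for x
    using D.maximalideal_scalar_residue[OF M(1) that] by metis
  have prime: "primeideal P A" using spec by (simp add: poisson_spec_def)
  have "D.rational P"
  proof (rule D.rational_of_greatest_stable[OF cring.maximalideal_prime[OF M_cring M(1)] _ prime])
    show "\<exists>c. x \<ominus> scalar c \<in> M" if "x \<in> carrier A" for x
      using residue[OF that] .
  qed (use core in blast)+
  then show ?thesis using poisson_rational_iff[OF spec] by simp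
qed

lemma poisson_rational_imp_gdelta:
  assumes P: "P \<in> poisson_spec A" "poisson_rational A P"
  shows "locally_gdelta_in (poisson_spec_topology A) {P}"
proof -
  obtain e where "countable_differential_algebra A scalar e (carrier A) (\<lambda>y x. \<lbrace>x, y\<rbrace>)"
    using countable_differential_algebra by (rule exE)
  then interpret D: countable_differential_algebra A scalar e "carrier A" "\<lambda>y x. \<lbrace>x, y\<rbrace>" .
  have prime: "primeideal P A" "D.stable P"
    using P(1) by (simp_all add: poisson_spec_def poisson_ideal_iff_stable)
  have "D.rational P" using P poisson_rational_iff by simp
  from D.rational_countable_witnesses[OF prime this]
  obtain w :: "nat \<Rightarrow> 'a" where w: "range w \<subseteq> carrier A - P"
    "\<And>Q. D.stable Q \<Longrightarrow> P \<subseteq> Q \<Longrightarrow> range w \<inter> Q = {} \<Longrightarrow> Q = P" by metis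
  \<comment> \<open>\<open>?C\<close> is the closure of the point \<open>P\<close>, and each
    \<open>?U n\<close> is a basic open neighbourhood of \<open>P\<close>.\<close>
  let ?C = "{Q \<in> poisson_spec A. P \<subseteq> Q}" and ?U = "\<lambda>n. {Q \<in> poisson_spec A. \<not> {w n} \<subseteq> Q}"
  have "P \<subseteq> carrier A" using prime(1) by (simp add: primeideal_def cring.ideal_iff_closed[OF M_cring])
  then have "closedin (poisson_spec_topology A) ?C"
    unfolding closedin_poisson_spec by (intro exI[of _ P]) simp
  moreover have "openin (poisson_spec_topology A) (?U n)" for n
    unfolding openin_poisson_spec using w(1) by (intro exI[of _ "{w n}"]) auto
  moreover have "{P} = ?C \<inter> (\<Inter>n. ?U n)"
  proof
    show "{P} \<subseteq> ?C \<inter> (\<Inter>n. ?U n)" using P(1) w(1) by auto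
    show "?C \<inter> (\<Inter>n. ?U n) \<subseteq> {P}"
    proof
      fix Q assume Q: "Q \<in> ?C \<inter> (\<Inter>n. ?U n)"
      then have "D.stable Q" by (simp add: poisson_spec_def poisson_ideal_iff_stable)
      moreover have "range w \<inter> Q = {}" using Q by auto
      ultimately show "Q \<in> {P}" using w(2) Q by simp
    qed
  qed
  ultimately show ?thesis
    unfolding locally_gdelta_in_def by (intro exI[of _ ?C] exI[of _ ?U]) simp
qed

text \<open>Each \<open>U n\<close> is shrunk to the basic open set of some \<open>w n\<close>
  outside \<open>P\<close>, and a maximal ideal above \<open>P\<close> that avoids every
  \<open>w n\<close> is chosen. Its core contains \<open>P\<close> and avoids every
  \<open>w n\<close>, so it lies in all the given sets and equals \<open>P\<close>.\<close>

lemma gdelta_imp_poisson_primitive: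
  assumes P: "P \<in> poisson_spec A" "locally_gdelta_in (poisson_spec_topology A) {P}"
  shows "poisson_primitive A P"
proof -
  obtain e where "countable_differential_algebra A scalar e (carrier A) (\<lambda>y x. \<lbrace>x, y\<rbrace>)"
    using countable_differential_algebra by (rule exE)
  then interpret D: countable_differential_algebra A scalar e "carrier A" "\<lambda>y x. \<lbrace>x, y\<rbrace>" .
  have prime: "primeideal P A" "poisson_ideal A P" using P(1) by (simp_all add: poisson_spec_def)
  obtain U C where U: "\<And>n::nat. openin (poisson_spec_topology A) (U n)"
    and C: "closedin (poisson_spec_topology A) C" and UC: "{P} = C \<inter> (\<Inter>n. U n)"
    using P(2) unfolding locally_gdelta_in_def by blast
  obtain T where T: "C = {Q \<in> poisson_spec A. T \<subseteq> Q}"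
    using C unfolding closedin_poisson_spec by (elim exE conjE)
  have "\<exists>w. w \<in> carrier A \<and> w \<notin> P \<and> {Q \<in> poisson_spec A. w \<notin> Q} \<subseteq> U n" for n
  proof -
    obtain S where S: "S \<subseteq> carrier A" "U n = {Q \<in> poisson_spec A. \<not> S \<subseteq> Q}"
      using U[of n] unfolding openin_poisson_spec by (elim exE conjE)
    have "P \<in> U n" using UC by blast
    then obtain w where "w \<in> S" "w \<notin> P" using S(2) by blast
    then show ?thesis using S by (intro exI[of _ w]) auto
  qed
  then obtain w where w: "\<And>n. w n \<in> carrier A" "\<And>n. w n \<notin> P"
    "\<And>n. {Q \<in> poisson_spec A. w n \<notin> Q} \<subseteq> U n" by metis
  have "countable (range w)" "range w \<subseteq> carrier A" "range w \<inter> P = {}" using w(1,2) by auto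
  from D.exists_maximalideal_avoiding[OF prime(1) this]
  obtain M where M: "maximalideal M A" "P \<subseteq> M" "M \<inter> range w = {}" by metis
  have id: "ideal M A" using M(1) by (rule maximalideal.axioms(1))
  define Q where "Q = poisson_core A M"
  have prim: "poisson_primitive A Q" using M(1) unfolding poisson_primitive_def Q_def by auto
  then have spec: "Q \<in> poisson_spec A" by (rule poisson_primitive_in_spec)
  have "P \<subseteq> Q" "Q \<subseteq> M" using poisson_core[OF id] prime(2) M(2) by (auto simp: Q_def)
  then have "T \<subseteq> Q" using UC T by blast
  then have "Q \<in> C" using T spec by simp
  moreover have "Q \<in> U n" for n using w(3)[of n] spec M(3) \<open>Q \<subseteq> M\<close> by auto
  ultimately have "Q = P" using UC by blast
  then show ?thesis using prim by simp
qed

text \<open>Primitive implies rational, rational implies locally G-delta, and this implies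
  primitive. Locally closed points are locally G-delta, so the equivalence amounts to the
  converse.\<close>

lemma poisson_dixmier_moeglin_iff:
  "poisson_dixmier_moeglin A \<longleftrightarrow> gdelta_points_locally_closed (poisson_spec_topology A)"
proof -
  let ?T = "poisson_spec_topology A"
  have 1: "poisson_primitive A P \<longleftrightarrow> P \<in> poisson_spec A \<and> locally_gdelta_in ?T {P}" for P
    using poisson_primitive_in_spec poisson_primitive_imp_rational poisson_rational_imp_gdelta
      gdelta_imp_poisson_primitive by metis
  moreover have 2: "P \<in> poisson_spec A \<and> poisson_rational A P \<longleftrightarrow>
      P \<in> poisson_spec A \<and> locally_gdelta_in ?T {P}" for P
    using poisson_primitive_imp_rational poisson_rational_imp_gdelta
      gdelta_imp_poisson_primitive by metis
  ultimately show ?thesis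
    using locally_closed_in_imp_gdelta[of ?T]
    unfolding poisson_dixmier_moeglin_def gdelta_points_locally_closed_def topspace_poisson_spec
      set_eq_iff mem_Collect_eq by metis
qed

end

theorem theoremB:
  fixes A :: "'a poisson_alg"
    and I :: "'i set"
    and S :: "'i \<Rightarrow> 'a set set"
    and B :: "'i \<Rightarrow> 'b poisson_alg"
  assumes "affine_poisson_algebra A"
    and "poisson_spec A = (\<Union>i\<in>I. S i)"
    and "\<And>i. i \<in> I \<Longrightarrow> locally_closed_in (poisson_spec_topology A) (S i)"
    and "\<And>i. i \<in> I \<Longrightarrow> affine_poisson_algebra (B i)"
    and "\<And>i. i \<in> I \<Longrightarrow>
           subtopology (poisson_spec_topology A) (S i) homeomorphic_space poisson_spec_topology (B i)"
  shows "poisson_dixmier_moeglin A \<longleftrightarrow> (\<forall>i\<in>I. poisson_dixmier_moeglin (B i))"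
proof -
  let ?T = "poisson_spec_topology A"
  have "gdelta_points_locally_closed (subtopology ?T (S i)) \<longleftrightarrow>
      gdelta_points_locally_closed (poisson_spec_topology (B i))" if "i \<in> I" for i
    using assms(5)[OF that] gdelta_points_locally_closed_homeomorphic homeomorphic_space_sym by metis
  then have "gdelta_points_locally_closed (subtopology ?T (S i)) \<longleftrightarrow>
      poisson_dixmier_moeglin (B i)" if "i \<in> I" for i
    using affine_poisson_algebra.poisson_dixmier_moeglin_iff[OF assms(4)[OF that]] that by simp
  moreover have "poisson_dixmier_moeglin A \<longleftrightarrow> gdelta_points_locally_closed ?T"
    using assms(1) by (rule affine_poisson_algebra.poisson_dixmier_moeglin_iff)
  moreover have "topspace ?T = (\<Union>i\<in>I. S i)" using assms(2) by (simp add: topspace_poisson_spec)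
  ultimately show ?thesis using gdelta_points_locally_closed_cover[of ?T S I] assms(3) by simp
qed

end
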